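(* Let $m\ge2$ be an integer and let $D=(D_i)_{i\ge1}$ be a sequence of digits in $\{0,\dots,m-1\}$. If $D$ satisfies Property $(\mathcal P)$, then $\sum_{i\ge1}D_im^{-i}$ is normal in basis $m$, i.e. for every $n_0\ge1$ and every $(\varepsilon_1,\dots,\varepsilon_{n_0})\in\{0,\dots,m-1\}^{n_0}$, $$\lim_{k\to\infty}\frac1k\#\{1\le i\le k:(D_i,\dots,D_{i+n_0-1})=(\varepsilon_1,\dots,\varepsilon_{n_0})\}=m^{-n_0}.$$
   Context: $\Sigma_m=\{0,\dots,m-1\}^{\mathbb N_+}$ with the product topology and the shift $T((t_n)_{n\ge1})=(t_{n+1})_{n\ge1}$. $\mathcal M(\Sigma_m,T)$ is the set of $T$-invariant Borel probability measures on $\Sigma_m$, $h_\nu(T)$ the entropy, $\nu(\Phi)=\int\Phi\,d\nu$. For a continuous $\Phi:\Sigma_m\to\mathbb R^d$ put $S_n\Phi=\sum_{i=0}^{n-1}\Phi\circ T^i$, $\mathcal D_I=\{\nu(\Phi):\nu\in\mathcal M(\Sigma_m,T)\}$ and $$I(x)=\inf\{\log m-h_\nu(T):\nu\in\mathcal M(\Sigma_m,T),\ \nu(\Phi)=x\}\ \text{ if }x\in\mathcal D_I,\qquad I(x)=\infty\text{ otherwise.}$$ Given a sequence $(k(n))_{n\ge1}$ of positive integers, let $\mu_n^D=\frac1{k(n)}\sum_{j=1}^{k(n)}\delta_{S_n\Phi(T^{(j-1)n}D)/n}$. Property $(\mathcal P)$: for every $d\ge1$, every continuous $\Phi:\Sigma_m\to\mathbb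 R^d$, and every increasing sequence of positive integers $(k(n))_{n\ge1}$ with $\liminf_{n\to\infty}\frac{\log k(n)}n>\sup_{x\in\mathcal D_I}I(x)$, the sequence $(\mu_n^D)_{n\ge1}$ satisfies in $\mathbb R^d$ the large deviation principle with rate function $I$, i.e. for all Borel $\Gamma\subset\mathbb R^d$, $-\inf_{\mathring\Gamma}I\le\liminf_n\frac1n\log\mu_n^D(\Gamma)\le\limsup_n\frac1n\log\mu_n^D(\Gamma)\le-\inf_{\overline\Gamma}I$. *)

theory Defs
  imports "HOL-Analysis.Analysis" "HOL-Library.Disjoint_Sets"
begin

text \<open>
  Digit sequences are indexed by the positive integers: a point of the shift space is a function on
  \<open>{1..}\<close> (as usual in HOL, extended by \<open>undefined\<close> at \<open>0\<close>). Points of \<open>\<real>\<^sup>d\<close> are the elements of the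
  library's \<open>Euclidean_space d\<close>, i.e. functions \<open>nat \<Rightarrow> real\<close> vanishing outside \<open>{..<d}\<close>, so
  that the dimension can be quantified over inside a formula.
\<close>

definition shift_top :: "nat \<Rightarrow> (nat \<Rightarrow> nat) topology" where
  "shift_top m = product_topology (\<lambda>_. discrete_topology {..<m}) {1..}"

definition shift_space :: "nat \<Rightarrow> (nat \<Rightarrow> nat) set" where
  "shift_space m = ({1..} \<rightarrow>\<^sub>E {..<m})"

lemma topspace_shift_top [simp]: "topspace (shift_top m) = shift_space m"
  by (simp add: shift_top_def shift_space_def topspace_product_topology)

definition shift :: "(nat \<Rightarrow> nat) \<Rightarrow> nat \<Rightarrow> nat" where
  "shift t = (\<lambda>n\<in>{1..}. t (n + 1))"

definition borel_of :: "'a topology \<Rightarrow> 'a measure" where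
  "borel_of X = sigma (topspace X) {U. openin X U}"

definition invariant_measures :: "nat \<Rightarrow> (nat \<Rightarrow> nat) measure set" where
  "invariant_measures m = {\<nu>. sets \<nu> = sets (borel_of (shift_top m)) \<and>
     emeasure \<nu> (space \<nu>) = 1 \<and>
     (\<forall>A\<in>sets \<nu>. emeasure \<nu> (shift -` A \<inter> space \<nu>) = emeasure \<nu> A)}"


subsection \<open>Kolmogorov-Sinai entropy\<close>

text \<open>The convention \<open>0 log 0 = 0\<close> holds automatically because \<open>0 * y = 0\<close>.\<close>

definition partition_entropy :: "'a measure \<Rightarrow> 'a set set \<Rightarrow> real" where
  "partition_entropy \<nu> P = - (\<Sum>A\<in>P. measure \<nu> A * ln (measure \<nu> A))"

definition iterated_join :: "'a measure \<Rightarrow> ('a \<Rightarrow> 'a) \<Rightarrow> 'a set set \<Rightarrow> nat \<Rightarrow> 'a set set" where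
  "iterated_join \<nu> T P n =
     common_refinement ((\<lambda>i. (\<lambda>A. (T ^^ i) -` A \<inter> space \<nu>) ` P) ` {..<n})"

text \<open>For measure-preserving \<open>T\<close> the limit below exists by subadditivity.\<close>

definition entropy_wrt_partition :: "'a measure \<Rightarrow> ('a \<Rightarrow> 'a) \<Rightarrow> 'a set set \<Rightarrow> real" where
  "entropy_wrt_partition \<nu> T P = lim (\<lambda>n. partition_entropy \<nu> (iterated_join \<nu> T P n) / real n)"

definition ks_entropy :: "'a measure \<Rightarrow> ('a \<Rightarrow> 'a) \<Rightarrow> ereal" where
  "ks_entropy \<nu> T =
     (SUP P\<in>{P. finite P \<and> P \<subseteq> sets \<nu> \<and> partition_on (space \<nu>) P}.
        ereal (entropy_wrt_partition \<nu> T P))"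


subsection \<open>The rate function and the empirical distributions\<close>

definition mean :: "'a measure \<Rightarrow> ('a \<Rightarrow> nat \<Rightarrow> real) \<Rightarrow> nat \<Rightarrow> real" where
  "mean \<nu> \<Phi> = (\<lambda>i. \<integral>t. \<Phi> t i \<partial>\<nu>)"

definition rate_domain :: "nat \<Rightarrow> ((nat \<Rightarrow> nat) \<Rightarrow> nat \<Rightarrow> real) \<Rightarrow> (nat \<Rightarrow> real) set" where
  "rate_domain m \<Phi> = (\<lambda>\<nu>. mean \<nu> \<Phi>) ` invariant_measures m"

definition rate :: "nat \<Rightarrow> ((nat \<Rightarrow> nat) \<Rightarrow> nat \<Rightarrow> real) \<Rightarrow> (nat \<Rightarrow> real) \<Rightarrow> ereal" where
  "rate m \<Phi> x =
     (if x \<in> rate_domain m \<Phi>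
      then INF \<nu>\<in>{\<nu>\<in>invariant_measures m. mean \<nu> \<Phi> = x}. ereal (ln (real m)) - ks_entropy \<nu> shift
      else \<infinity>)"

definition birkhoff_average ::
  "((nat \<Rightarrow> nat) \<Rightarrow> nat \<Rightarrow> real) \<Rightarrow> nat \<Rightarrow> (nat \<Rightarrow> nat) \<Rightarrow> nat \<Rightarrow> real" where
  "birkhoff_average \<Phi> n t = (\<lambda>i. (\<Sum>l<n. \<Phi> ((shift ^^ l) t) i) / real n)"

text \<open>The value on \<open>\<Gamma>\<close> of \<open>\<mu>\<^sub>n\<^sup>D\<close>, the average of \<open>N = k(n)\<close> Dirac masses.\<close>

definition empirical_distribution ::
  "((nat \<Rightarrow> nat) \<Rightarrow> nat \<Rightarrow> real) \<Rightarrow> (nat \<Rightarrow> nat) \<Rightarrow> nat \<Rightarrow> nat \<Rightarrow> (nat \<Rightarrow> real) set \<Rightarrow> real" where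
  "empirical_distribution \<Phi> D n N \<Gamma> =
     (\<Sum>j=1..N. indicator \<Gamma> (birkhoff_average \<Phi> n ((shift ^^ ((j - 1) * n)) D))) / real N"


subsection \<open>Large deviations\<close>

text \<open>The real \<open>ln\<close> has \<open>ln 0 = 0\<close>; here the logarithm of a null probability must be \<open>-\<infinity>\<close>.\<close>

definition elog :: "real \<Rightarrow> ereal" where
  "elog p = (if p = 0 then -\<infinity> else ereal (ln p))"

definition satisfies_LDP :: "'a topology \<Rightarrow> (nat \<Rightarrow> 'a set \<Rightarrow> real) \<Rightarrow> ('a \<Rightarrow> ereal) \<Rightarrow> bool" where
  "satisfies_LDP X \<mu> I \<longleftrightarrow> (\<forall>\<Gamma>\<in>sets (borel_of X).
     - (INF x\<in>X interior_of \<Gamma>. I x) \<le> liminf (\<lambda>n. ereal (1 / real n) * elog (\<mu> n \<Gamma>)) \<and>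
     liminf (\<lambda>n. ereal (1 / real n) * elog (\<mu> n \<Gamma>))
       \<le> limsup (\<lambda>n. ereal (1 / real n) * elog (\<mu> n \<Gamma>)) \<and>
     limsup (\<lambda>n. ereal (1 / real n) * elog (\<mu> n \<Gamma>)) \<le> - (INF x\<in>X closure_of \<Gamma>. I x))"

definition property_P :: "nat \<Rightarrow> (nat \<Rightarrow> nat) \<Rightarrow> bool" where
  "property_P m D \<longleftrightarrow>
     (\<forall>d \<Phi> k. d \<ge> 1 \<longrightarrow> continuous_map (shift_top m) (Euclidean_space d) \<Phi> \<longrightarrow>
        (\<forall>n\<ge>1. k n \<ge> (1::nat)) \<longrightarrow> strict_mono_on {1..} k \<longrightarrow>
        liminf (\<lambda>n. ereal (ln (real (k n)) / real n)) > (SUP x\<in>rate_domain m \<Phi>. rate m \<Phi> x) \<longrightarrow>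
        satisfies_LDP (Euclidean_space d)
          (\<lambda>n. empirical_distribution \<Phi> D n (k n)) (rate m \<Phi>))"

end

theory Submission
  imports Defs "HOL-Probability.Probability_Measure"
begin

text \<open>
  Fix a word \<open>\<epsilon>\<close> of length \<open>l\<close>, let \<open>C\<close> be the cylinder of the points starting with \<open>\<epsilon>\<close>, and let
  \<open>p = m\<^sup>-\<^sup>l\<close>. Property \<open>\<P>\<close> is applied to the indicator of \<open>C\<close>, a continuous function with values in
  \<open>\<real>\<close>. The rate function of this observable is bounded away from \<open>0\<close> outside every neighbourhood of
  \<open>p\<close>, because an invariant measure \<open>\<nu>\<close> with \<open>\<bar>\<nu>(C) - p\<bar> \<ge> \<delta>\<close> satisfies
  \<open>h\<^sub>\<nu> \<le> log m - \<delta>\<^sup>2 / (2l)\<close> (lemma \<open>entropy_gap\<close>). Hence, for every admissible \<open>k\<close>, the proportion of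
  those among the first \<open>k(n)\<close> blocks of length \<open>n\<close> in \<open>D\<close> in which the frequency of \<open>\<epsilon>\<close> is \<open>\<delta>\<close>-far
  from \<open>p\<close> tends to \<open>0\<close>; averaging over the blocks, the frequency of \<open>\<epsilon>\<close> in the first \<open>K\<close> digits is
  close to \<open>p\<close> as soon as \<open>K div n = k(n)\<close> (lemma \<open>frequency_block_estimate\<close>).

  The only condition on \<open>k\<close> is a lower bound on its growth: the rate is at most \<open>log m\<close> on its domain, so
  every strictly increasing \<open>k\<close> with \<open>k(n) \<ge> (m + 1)\<^sup>n\<close> is admissible. If the frequencies did not converge
  to \<open>p\<close>, they would be far from \<open>p\<close> for infinitely many lengths \<open>K\<close>, and one could choose such lengths
  \<open>K(n)\<close> growing so fast that \<open>k(n) = K(n) div n\<close> is admissible. This is a contradiction.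

  The entropy gap has to be proved for the supremum over all finite measurable partitions \<open>P\<close>. The proof
  bounds the entropy of the join of \<open>n\<close> shifted copies of \<open>P\<close> by Gibbs' inequality: the entropy of a
  distribution \<open>p\<close> is at most \<open>- \<Sum> p log q\<close> for every subprobability \<open>q\<close> (lemma
  \<open>neg_sum_mult_ln_le\<close>). The subprobability is the law of a random itinerary produced as follows. Choose
  independent words of length \<open>l\<close>, where \<open>\<epsilon>\<close> has the weight \<open>exp s\<close> relative to every other word, and
  concatenate them to a digit sequence \<open>w\<close>. Take a function \<open>\<phi>\<close> into \<open>P\<close> that depends on finitely many
  digits and is the right atom up to a set of small measure; it exists because measurable sets
  are approximated by finite unions of cylinders. The \<open>i\<close>-th entry of the itinerary is \<open>\<phi>\<close> at the \<open>i\<close>-th shift of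
  \<open>w\<close> with probability close to \<open>1\<close>, and spread uniformly over \<open>P\<close> otherwise. The resulting bound is, up
  to small errors, \<open>(log (m\<^sup>l - 1 + exp s) - s \<nu>(C)) / l\<close> per unit of time, and a choice of the tilt \<open>s\<close>
  with \<open>\<bar>s\<bar> = \<delta>\<close> turns it into the entropy gap. The limit in the definition of the
  entropy exists by subadditivity, which is another application of Gibbs' inequality.
\<close>

section \<open>Finite sums and real sequences\<close>

text \<open>
  Gibbs' inequality. The last assumption is absolute continuity; without it the convention
  \<open>ln 0 = 0\<close> would make the right-hand side too small.
\<close>

lemma neg_sum_mult_ln_le:
  fixes p q :: "'a \<Rightarrow> real"
  assumes "\<And>x. x \<in> S \<Longrightarrow> 0 \<le> p x" "sum p S = 1"
    and "\<And>x. x \<in> S \<Longrightarrow> 0 \<le> q x" "sum q S \<le> 1"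
    and "\<And>x. x \<in> S \<Longrightarrow> 0 < p x \<Longrightarrow> 0 < q x"
  shows "- (\<Sum>x\<in>S. p x * ln (p x)) \<le> - (\<Sum>x\<in>S. p x * ln (q x))"
proof -
  have "p x * ln (q x) - p x * ln (p x) \<le> q x - p x" if "x \<in> S" for x
  proof (cases "p x = 0")
    case False
    with assms that have p: "0 < p x" and q: "0 < q x"
      by (auto simp: order.strict_iff_order)
    have "p x * ln (q x) - p x * ln (p x) = p x * ln (q x / p x)"
      using p q by (simp add: ln_div algebra_simps)
    also have "\<dots> \<le> p x * (q x / p x - 1)"
      using p q by (intro mult_left_mono ln_le_minus_one) auto
    also have "\<dots> = q x - p x"
      using p by (simp add: field_simps)
    finally show ?thesis .
  qed (use assms that in auto)
  hence "(\<Sum>x\<in>S. p x * ln (q x) - p x * ln (p x)) \<le> (\<Sum>x\<in>S. q x - p x)"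
    by (rule sum_mono)
  thus ?thesis
    using assms by (simp add: sum_subtractf)
qed

text \<open>
  Fekete's lemma, for nonnegative sequences, where the limit is finite.
\<close>

lemma subadditive_imp_convergent:
  fixes a :: "nat \<Rightarrow> real"
  assumes nonneg: "\<And>n. 0 \<le> a n" and sub: "\<And>n k. a (n + k) \<le> a n + a k"
  shows "convergent (\<lambda>n. a n / real n)"
proof -
  define l where "l = (INF n\<in>{1..}. a n / real n)"
  have bdd: "bdd_below ((\<lambda>n. a n / real n) ` {1..})"
    using nonneg by (intro bdd_belowI2[of _ 0]) auto
  have "(\<lambda>n. a n / real n) \<longlonglongrightarrow> l"
  proof (rule LIMSEQ_I)
    fix e :: real assume e: "0 < e"
    have "\<exists>N\<in>{1..}. a N / real N < l + e / 2"
      using e bdd unfolding l_def by (subst cINF_less_iff[symmetric]) auto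
    then obtain N where N: "1 \<le> N" "a N / real N < l + e / 2"
      by auto
    define C where "C = (\<Sum>r<N. a r)"
    \<comment> \<open>Replacing \<open>n\<close> by \<open>n div N\<close> copies of \<open>N\<close> and a remainder costs a bounded amount \<open>C\<close>.\<close>
    have mult: "a (q * N + r) \<le> real q * a N + a r" for q r
    proof (induction q)
      case (Suc q)
      have "a (Suc q * N + r) \<le> a N + a (q * N + r)"
        using sub[of N "q * N + r"] by (simp add: algebra_simps)
      with Suc show ?case by (simp add: algebra_simps)
    qed auto
    have upper: "a n / real n \<le> a N / real N + C / real n" if "1 \<le> n" for n
    proof -
      have "a n \<le> real (n div N) * a N + a (n mod N)"
        using mult[of "n div N" "n mod N"] by simp
      also have "a (n mod N) \<le> C"
        unfolding C_def using N nonneg by (intro member_le_sum) auto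
      also have "real (n div N) * a N \<le> (real n / real N) * a N"
        using nonneg N by (intro mult_right_mono of_nat_div_le_of_nat) auto
      finally show ?thesis
        using that N by (simp add: field_simps)
    qed
    obtain n0 where n0: "C / e * 2 < real n0" using reals_Archimedean2 by blast
    show "\<exists>n0. \<forall>n\<ge>n0. norm (a n / real n - l) < e"
    proof (intro exI allI impI)
      fix n assume n: "max 1 n0 \<le> n"
      have "l \<le> a n / real n"
        unfolding l_def using n bdd by (intro cINF_lower) auto
      moreover have "C / real n < e / 2"
        using n n0 e by (simp add: field_simps) (smt (verit) mult_left_mono of_nat_mono)
      ultimately show "norm (a n / real n - l) < e"
        using upper[of n] n N(2) e unfolding real_norm_def by linarith
    qed
  qed
  thus ?thesis by (rule convergentI)
qed

text \<open>
  With \<open>f\<close> and \<open>g\<close> the laws of itineraries of length \<open>n\<close> and \<open>k\<close>, this says that their independent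
  concatenation has total mass \<open>1\<close>.
\<close>

lemma sum_PiE_split:
  fixes f g :: "(nat \<Rightarrow> 'a) \<Rightarrow> real"
  shows "(\<Sum>x\<in>{..<n + k} \<rightarrow>\<^sub>E P. f (restrict x {..<n}) * g (\<lambda>i\<in>{..<k}. x (n + i)))
    = (\<Sum>y\<in>{..<n} \<rightarrow>\<^sub>E P. f y) * (\<Sum>z\<in>{..<k} \<rightarrow>\<^sub>E P. g z)"
proof -
  let ?split = "\<lambda>x. (restrict x {..<n}, \<lambda>i\<in>{..<k}. x (n + i))"
  let ?join = "\<lambda>(y, z). \<lambda>i\<in>{..<n + k}. if i < n then y i else z (i - n)"
  have "bij_betw ?split ({..<n + k} \<rightarrow>\<^sub>E P) (({..<n} \<rightarrow>\<^sub>E P) \<times> ({..<k} \<rightarrow>\<^sub>E P))"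
  proof (rule bij_betw_byWitness[where f' = ?join])
    show "\<forall>x\<in>{..<n + k} \<rightarrow>\<^sub>E P. ?join (?split x) = x"
    proof
      fix x assume x: "x \<in> {..<n + k} \<rightarrow>\<^sub>E P"
      show "?join (?split x) = x"
        unfolding prod.case
        by (rule extensionalityI[of _ "{..<n + k}"]) (use x in \<open>auto simp: PiE_iff\<close>)
    qed
    show "\<forall>b\<in>({..<n} \<rightarrow>\<^sub>E P) \<times> ({..<k} \<rightarrow>\<^sub>E P). ?split (?join b) = b"
    proof
      fix b assume "b \<in> ({..<n} \<rightarrow>\<^sub>E P) \<times> ({..<k} \<rightarrow>\<^sub>E P)"
      then obtain y z where b: "b = (y, z)" "y \<in> {..<n} \<rightarrow>\<^sub>E P" "z \<in> {..<k} \<rightarrow>\<^sub>E P" by blast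
      have "restrict (\<lambda>i\<in>{..<n + k}. if i < n then y i else z (i - n)) {..<n} = y"
        by (rule extensionalityI[of _ "{..<n}"]) (use b in \<open>auto simp: PiE_iff\<close>)
      moreover have "(\<lambda>i\<in>{..<k}. (\<lambda>i\<in>{..<n + k}. if i < n then y i else z (i - n)) (n + i)) = z"
      proof (rule extensionalityI[of _ "{..<k}"])
        show "z \<in> extensional {..<k}" using b(3) by (simp add: PiE_def)
      qed simp_all
      ultimately show "?split (?join b) = b" unfolding b(1) prod.case by (simp only:)
    qed
    show "?split ` ({..<n + k} \<rightarrow>\<^sub>E P) \<subseteq> ({..<n} \<rightarrow>\<^sub>E P) \<times> ({..<k} \<rightarrow>\<^sub>E P)"
    proof (rule image_subsetI)
      fix x assume x: "x \<in> {..<n + k} \<rightarrow>\<^sub>E P"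
      have "restrict x {..<n} \<in> {..<n} \<rightarrow>\<^sub>E P" "(\<lambda>i\<in>{..<k}. x (n + i)) \<in> {..<k} \<rightarrow>\<^sub>E P"
        using PiE_mem[OF x] by simp_all
      thus "?split x \<in> ({..<n} \<rightarrow>\<^sub>E P) \<times> ({..<k} \<rightarrow>\<^sub>E P)" by (rule SigmaI)
    qed
    show "?join ` (({..<n} \<rightarrow>\<^sub>E P) \<times> ({..<k} \<rightarrow>\<^sub>E P)) \<subseteq> {..<n + k} \<rightarrow>\<^sub>E P"
    proof
      fix x assume "x \<in> ?join ` (({..<n} \<rightarrow>\<^sub>E P) \<times> ({..<k} \<rightarrow>\<^sub>E P))"
      then obtain b where bx: "b \<in> ({..<n} \<rightarrow>\<^sub>E P) \<times> ({..<k} \<rightarrow>\<^sub>E P)" "x = ?join b" by (rule imageE)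
      then obtain y z where b: "b = (y, z)" and y: "y \<in> {..<n} \<rightarrow>\<^sub>E P" and z: "z \<in> {..<k} \<rightarrow>\<^sub>E P"
        by blast
      have x: "x = (\<lambda>i\<in>{..<n + k}. if i < n then y i else z (i - n))"
        using bx(2) unfolding b prod.case .
      have "(if i < n then y i else z (i - n)) \<in> P" if "i < n + k" for i
        using that PiE_mem[OF y, of i] PiE_mem[OF z, of "i - n"] by auto
      thus "x \<in> {..<n + k} \<rightarrow>\<^sub>E P"
        unfolding x by (intro restrict_PiE_iff[THEN iffD2]) auto
    qed
  qed
  from sum.reindex_bij_betw[OF this, of "\<lambda>(y, z). f y * g z"] show ?thesis
    by (simp add: sum_product sum.cartesian_product)
qed

text \<open>
  The summands are the probabilities of a kernel that keeps \<open>y\<close> with probability about \<open>1 - \<eta>\<close> and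
  forgets it otherwise. Leaving the diagonal entry at \<open>1 - \<eta>\<close> makes it a subprobability and keeps its
  logarithm simple.
\<close>

lemma sum_near_diagonal_kernel_le:
  fixes \<eta> :: real
  assumes "finite P" "y \<in> P" "0 < \<eta>"
  shows "(\<Sum>x\<in>P. if x = y then 1 - \<eta> else \<eta> / real (card P)) \<le> 1"
proof -
  have c: "0 < real (card P)" using assms by (auto simp: card_gt_0_iff)
  have "(\<Sum>x\<in>P. if x = y then 1 - \<eta> else \<eta> / real (card P))
      = (1 - \<eta>) + (\<Sum>x\<in>P - {y}. if x = y then 1 - \<eta> else \<eta> / real (card P))"
    using assms by (subst sum.remove[of P y]) auto
  also have "(\<Sum>x\<in>P - {y}. if x = y then 1 - \<eta> else \<eta> / real (card P)) = (\<Sum>x\<in>P - {y}. \<eta> / real (card P))"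
    by (intro sum.cong) auto
  also have "\<dots> \<le> (\<Sum>x\<in>P. \<eta> / real (card P))"
    using assms by (intro sum_mono2) auto
  also have "\<dots> = \<eta>" using c by simp
  finally show ?thesis by simp
qed

lemma sum_tilted_weight:
  fixes s :: real
  assumes "finite W" "e \<in> W" "0 < Z" "Z = real (card W) - 1 + exp s"
  shows "(\<Sum>w\<in>W. exp (if w = e then s else 0) / Z) = 1"
proof -
  have "(\<Sum>w\<in>W. exp (if w = e then s else 0)) = exp s + (\<Sum>w\<in>W - {e}. exp (if w = e then s else 0))"
    using assms by (subst sum.remove[of W e]) auto
  also have "(\<Sum>w\<in>W - {e}. exp (if w = e then s else 0)) = (\<Sum>w\<in>W - {e}. 1)"
    by (intro sum.cong) auto
  also have "\<dots> = real (card W) - 1"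
  proof -
    have "0 < card W" using assms by (auto simp: card_gt_0_iff)
    thus ?thesis using assms by (simp add: card_Diff_singleton of_nat_diff)
  qed
  finally show ?thesis using assms by (simp add: sum_divide_distrib[symmetric])
qed

lemma LIMSEQ_div_over:
  assumes "1 \<le> l"
  shows "(\<lambda>n. real ((n + q) div l + 1) / real n) \<longlonglongrightarrow> 1 / real l"
proof (rule tendsto_sandwich)
  show "\<forall>\<^sub>F n in sequentially. real ((n + q) div l + 1) / real n \<le> 1 / real l + (real q / real l + 1) * (1 / real n)"
  proof (rule eventually_sequentiallyI[of 1])
    fix n :: nat assume n: "1 \<le> n"
    have "real ((n + q) div l) \<le> real (n + q) / real l" by (rule of_nat_div_le_of_nat)
    hence "real ((n + q) div l + 1) / real n \<le> (real (n + q) / real l + 1) / real n"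
      by (intro divide_right_mono) auto
    also have "\<dots> = 1 / real l + (real q / real l + 1) * (1 / real n)"
      using n assms by (simp add: field_simps)
    finally show "real ((n + q) div l + 1) / real n \<le> 1 / real l + (real q / real l + 1) * (1 / real n)" .
  qed
  show "\<forall>\<^sub>F n in sequentially. 1 / real l \<le> real ((n + q) div l + 1) / real n"
  proof (rule eventually_sequentiallyI[of 1])
    fix n :: nat assume n: "1 \<le> n"
    have "n + q < ((n + q) div l + 1) * l"
      using assms dividend_less_div_times[of l "n + q"] by simp
    hence "n \<le> ((n + q) div l + 1) * l" by simp
    hence "real n \<le> real ((n + q) div l + 1) * real l" by (metis of_nat_le_iff of_nat_mult)
    thus "1 / real l \<le> real ((n + q) div l + 1) / real n"
      using n assms by (simp add: field_simps)
  qed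
  show "(\<lambda>_. 1 / real l) \<longlonglongrightarrow> 1 / real l" by (rule tendsto_const)
  have "(\<lambda>n. 1 / real l + (real q / real l + 1) * (1 / real n)) \<longlonglongrightarrow> 1 / real l + (real q / real l + 1) * 0"
    by (intro tendsto_intros lim_1_over_n)
  thus "(\<lambda>n. 1 / real l + (real q / real l + 1) * (1 / real n)) \<longlonglongrightarrow> 1 / real l" by simp
qed

lemma exp_le_quadratic:
  fixes s :: real
  assumes "\<bar>s\<bar> \<le> 1"
  shows "exp s \<le> 1 + s + s\<^sup>2"
proof (cases "0 \<le> s")
  case True
  thus ?thesis using assms by (intro exp_bound) auto
next
  case False
  define u where "u = - s"
  have u: "0 < u" using False by (simp add: u_def)
  have pos: "0 < 1 - u + u\<^sup>2"
  proof -
    have "0 < (1 - u)\<^sup>2 + u" using u by (simp add: add_nonneg_pos)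
    thus ?thesis by (simp add: power2_eq_square algebra_simps)
  qed
  have "1 \<le> (1 - u + u\<^sup>2) * (1 + u + u\<^sup>2 / 2)"
  proof -
    have "(1 - u + u\<^sup>2) * (1 + u + u\<^sup>2 / 2) = 1 + u\<^sup>2 / 2 + u * u\<^sup>2 / 2 + u\<^sup>2 * u\<^sup>2 / 2"
      by (simp add: power2_eq_square field_simps)
    thus ?thesis using u by simp
  qed
  also have "\<dots> \<le> (1 - u + u\<^sup>2) * exp u"
    using pos u by (intro mult_left_mono exp_lower_Taylor_quadratic) auto
  finally have "exp (- u) \<le> 1 - u + u\<^sup>2"
    by (simp add: exp_minus field_simps)
  thus ?thesis by (simp add: u_def)
qed

text \<open>
  The left-hand side is the cross entropy between a distribution giving the mass \<open>p\<close> to one of \<open>M\<close>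
  points and the uniform distribution tilted by \<open>exp s\<close> at that point. Its derivative in \<open>s\<close> at \<open>0\<close> is
  \<open>1 / M - p\<close> and it is nearly quadratic in \<open>s\<close>, so a tilt of size \<open>\<delta>\<close> in the direction of the
  deviation gains of the order of \<open>\<delta>\<^sup>2\<close>.
\<close>

lemma ex_tilt:
  fixes p M \<delta> :: real
  assumes M: "2 \<le> M" and \<delta>: "0 < \<delta>" "\<delta> \<le> 1" and p: "\<delta> \<le> \<bar>p - 1 / M\<bar>"
  shows "\<exists>s. ln (M - 1 + exp s) - s * p \<le> ln M - \<delta>\<^sup>2 / 2"
proof -
  define s where "s = (if 1 / M \<le> p then \<delta> else - \<delta>)"
  have sp: "\<delta>\<^sup>2 \<le> s * (p - 1 / M)"
  proof -
    have "s * (p - 1 / M) = \<delta> * \<bar>p - 1 / M\<bar>"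
      by (cases "1 / M \<le> p") (simp_all add: s_def abs_if algebra_simps)
    thus ?thesis using p \<delta> by (simp add: power2_eq_square)
  qed
  have s2: "s\<^sup>2 = \<delta>\<^sup>2" by (simp add: s_def)
  have exp: "exp s - 1 \<le> s + \<delta>\<^sup>2"
    using exp_le_quadratic[of s] \<delta> s2 by (auto simp: s_def)
  have arg: "0 < 1 + (exp s - 1) / M"
  proof -
    have "0 < M - 1 + exp s" using M exp_gt_zero[of s] by linarith
    thus ?thesis using M by (simp add: field_simps)
  qed
  have fac: "M - 1 + exp s = M * (1 + (exp s - 1) / M)" using M by (simp add: field_simps)
  have "ln (M - 1 + exp s) = ln M + ln (1 + (exp s - 1) / M)"
    unfolding fac using M arg by (auto simp: ln_mult)
  also have "\<dots> \<le> ln M + (exp s - 1) / M"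
    using ln_le_minus_one[OF arg] by simp
  also have "\<dots> \<le> ln M + (s + \<delta>\<^sup>2) / M"
    using exp M by (intro add_left_mono divide_right_mono) auto
  finally have "ln (M - 1 + exp s) - s * p \<le> ln M - s * (p - 1 / M) + \<delta>\<^sup>2 / M"
    by (simp add: add_divide_distrib algebra_simps)
  also have "\<dots> \<le> ln M - \<delta>\<^sup>2 + \<delta>\<^sup>2 / 2"
    using sp M by (intro add_mono diff_left_mono divide_left_mono) auto
  finally show ?thesis by (intro exI[of _ s]) simp
qed

text \<open>
  \<open>\<mu>\<close> is the proportion of blocks with a deviating average. A deviating block contributes at most
  \<open>1\<close> to the total deviation, any other block at most \<open>\<delta>\<close>; the incomplete last block has fewer than
  \<open>n\<close> entries and thus the weight at most \<open>1 / (K div n)\<close>.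
\<close>

lemma frequency_block_estimate:
  fixes a :: "nat \<Rightarrow> real" and p \<delta> :: real
  assumes a: "\<And>i. 0 \<le> a i" "\<And>i. a i \<le> 1" and p: "0 \<le> p" "p \<le> 1"
    and n: "1 \<le> n" and N: "1 \<le> K div n" and \<delta>: "0 \<le> \<delta>"
  defines "\<mu> \<equiv> (\<Sum>j<K div n. of_bool (\<delta> \<le> \<bar>(\<Sum>i<n. a (j * n + i)) / real n - p\<bar>)) / real (K div n)"
  shows "\<bar>(\<Sum>i<K. a i) / real K - p\<bar> \<le> \<delta> + \<mu> + 1 / real (K div n)"
proof -
  define N where "N = K div n"
  have N1: "1 \<le> N" using N by (simp add: N_def)
  have NK: "N * n \<le> K" by (simp add: N_def)
  have KN: "K < N * n + n" using n dividend_less_div_times[of n K] by (simp add: N_def)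
  have dev: "\<bar>(\<Sum>i<n. a (j * n + i)) - real n * p\<bar>
      \<le> real n * (\<delta> + of_bool (\<delta> \<le> \<bar>(\<Sum>i<n. a (j * n + i)) / real n - p\<bar>))" for j
  proof -
    define b where "b = (\<Sum>i<n. a (j * n + i)) / real n"
    have "(\<Sum>i<n. a (j * n + i)) \<le> (\<Sum>i<n. 1)" by (intro sum_mono a)
    hence b: "0 \<le> b" "b \<le> 1" using n by (auto simp: b_def intro!: divide_nonneg_nonneg sum_nonneg a)
    have eq: "(\<Sum>i<n. a (j * n + i)) - real n * p = real n * (b - p)"
      using n by (simp add: b_def field_simps)
    have "\<bar>(\<Sum>i<n. a (j * n + i)) - real n * p\<bar> = real n * \<bar>b - p\<bar>"
      unfolding eq by (simp add: abs_mult)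
    also have "\<dots> \<le> real n * (\<delta> + of_bool (\<delta> \<le> \<bar>b - p\<bar>))"
      using b p \<delta> by (intro mult_left_mono) auto
    finally show ?thesis by (simp add: b_def)
  qed
  have "(\<Sum>i\<in>{j * n..<j * n + n}. a i - p) = (\<Sum>i<n. a (j * n + i) - p)" for j
    using sum.shift_bounds_nat_ivl[of "\<lambda>i. a i - p" 0 "j * n" n]
    by (simp add: add.commute lessThan_atLeast0)
  hence "(\<Sum>i<N * n. a i - p) = (\<Sum>j<N. \<Sum>i<n. a (j * n + i) - p)"
    by (simp only: sum.nat_group[symmetric])
  hence "\<bar>\<Sum>i<N * n. a i - p\<bar> = \<bar>\<Sum>j<N. (\<Sum>i<n. a (j * n + i)) - real n * p\<bar>"
    by (simp add: sum_subtractf)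
  also have "\<dots> \<le> (\<Sum>j<N. \<bar>(\<Sum>i<n. a (j * n + i)) - real n * p\<bar>)" by (rule sum_abs)
  also have "\<dots> \<le> (\<Sum>j<N. real n * (\<delta> + of_bool (\<delta> \<le> \<bar>(\<Sum>i<n. a (j * n + i)) / real n - p\<bar>)))"
    by (intro sum_mono dev)
  also have "\<dots> = real n * real N * (\<delta> + \<mu>)"
    using N1 by (simp add: \<mu>_def N_def[symmetric] sum_distrib_left[symmetric] sum.distrib field_simps)
  finally have main: "\<bar>\<Sum>i<N * n. a i - p\<bar> \<le> real n * real N * (\<delta> + \<mu>)" .
  have rest: "\<bar>\<Sum>i=N * n..<K. a i - p\<bar> \<le> real n"
  proof -
    have "\<bar>\<Sum>i=N * n..<K. a i - p\<bar> \<le> (\<Sum>i=N * n..<K. \<bar>a i - p\<bar>)" by (rule sum_abs)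
    also have "\<dots> \<le> (\<Sum>i=N * n..<K. 1)"
    proof (rule sum_mono)
      show "\<bar>a i - p\<bar> \<le> 1" for i using a[of i] p by linarith
    qed
    also have "\<dots> \<le> real n" using KN by simp
    finally show ?thesis .
  qed
  have K: "0 < real K" using N1 NK n by (metis Suc_le_eq One_nat_def mult_eq_0_iff not_less_zero of_nat_0_less_iff le_zero_eq gr0I)
  have "(\<Sum>i<K. a i) - real K * p = (\<Sum>i<K. a i - p)" by (simp add: sum_subtractf)
  also have "\<dots> = (\<Sum>i<N * n. a i - p) + (\<Sum>i=N * n..<K. a i - p)"
    using NK by (simp add: lessThan_atLeast0 sum.atLeastLessThan_concat)
  finally have "\<bar>(\<Sum>i<K. a i) - real K * p\<bar> \<le> real n * real N * (\<delta> + \<mu>) + real n"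
    using main rest by linarith
  also have "\<dots> = real (N * n) * (\<delta> + \<mu> + 1 / real N)"
    using N1 by (simp add: field_simps)
  also have "\<dots> \<le> real K * (\<delta> + \<mu> + 1 / real N)"
  proof (intro mult_right_mono)
    show "real (N * n) \<le> real K" using NK by (simp only: of_nat_le_iff)
    show "0 \<le> \<delta> + \<mu> + 1 / real N" using \<delta> by (auto simp: \<mu>_def intro!: add_nonneg_nonneg divide_nonneg_nonneg sum_nonneg)
  qed
  finally have "\<bar>(\<Sum>i<K. a i) - real K * p\<bar> / real K \<le> \<delta> + \<mu> + 1 / real N"
    using K by (simp add: field_simps)
  moreover have "\<bar>(\<Sum>i<K. a i) - real K * p\<bar> / real K = \<bar>(\<Sum>i<K. a i) / real K - p\<bar>"
  proof -
    have "(\<Sum>i<K. a i) / real K - p = ((\<Sum>i<K. a i) - real K * p) / real K" using K by (simp add: field_simps)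
    thus ?thesis using K by simp
  qed
  ultimately show ?thesis by (simp add: N_def)
qed

section \<open>Entropy of a partition under a measure-preserving map\<close>

text \<open>
  The atoms of the iterated join are indexed by itineraries \<open>x\<close>, with possibly empty cells: sums
  over itineraries are sums over a product set and can be factored.
\<close>

definition itinerary_cell :: "'a measure \<Rightarrow> ('a \<Rightarrow> 'a) \<Rightarrow> nat \<Rightarrow> (nat \<Rightarrow> 'a set) \<Rightarrow> 'a set" where
  "itinerary_cell M T n x = {t \<in> space M. \<forall>i<n. (T ^^ i) t \<in> x i}"

definition itinerary_entropy :: "'a measure \<Rightarrow> ('a \<Rightarrow> 'a) \<Rightarrow> 'a set set \<Rightarrow> nat \<Rightarrow> real" where
  "itinerary_entropy M T P n = - (\<Sum>x\<in>{..<n} \<rightarrow>\<^sub>E P.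
     measure M (itinerary_cell M T n x) * ln (measure M (itinerary_cell M T n x)))"

text \<open>
  For \<open>n = 0\<close> the join of no partitions is the one-element partition of the whole type, not of the space; this
  is why \<open>n\<close> is positive here.
\<close>

lemma iterated_join_eq_cells:
  assumes P: "partition_on (space M) P" and T: "\<And>t. t \<in> space M \<Longrightarrow> T t \<in> space M" and n: "1 \<le> n"
  shows "iterated_join M T P n = itinerary_cell M T n ` ({..<n} \<rightarrow>\<^sub>E P) - {{}}"
proof -
  define pre where "pre i A = (T ^^ i) -` A \<inter> space M" for i A
  have Ti: "(T ^^ i) t \<in> space M" if "t \<in> space M" for i t
    using that T by (induction i) auto
  have join: "iterated_join M T P n = common_refinement ((\<lambda>i. pre i ` P) ` {..<n})"
    unfolding iterated_join_def pre_def ..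
  have cell_eq: "itinerary_cell M T n x = (\<Inter>i<n. pre i (x i))" for x
    using n by (auto simp: itinerary_cell_def pre_def lessThan_empty_iff)
  have disj: "A = B" if "A \<in> P" "B \<in> P" "t \<in> A" "t \<in> B" for A B t
    using P that unfolding partition_on_def disjoint_def by auto
  show ?thesis
  proof (rule set_eqI iffI)+
    fix X assume "X \<in> iterated_join M T P n"
    then obtain f where f: "\<And>Q. Q \<in> (\<lambda>i. pre i ` P) ` {..<n} \<Longrightarrow> f Q \<in> Q"
      and X: "X = (\<Inter>Q\<in>(\<lambda>i. pre i ` P) ` {..<n}. f Q)" "X \<noteq> {}"
      unfolding join common_refinement_def by (auto simp: PiE_iff)
    have "\<exists>A\<in>P. f (pre i ` P) = pre i A" if "i < n" for i
      using f[of "pre i ` P"] that by auto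
    then obtain x where x: "\<And>i. i < n \<Longrightarrow> x i \<in> P \<and> f (pre i ` P) = pre i (x i)"
      by metis
    have "X = (\<Inter>i<n. pre i (x i))" using X(1) x by auto
    also have "\<dots> = itinerary_cell M T n (restrict x {..<n})"
      by (simp add: cell_eq)
    finally show "X \<in> itinerary_cell M T n ` ({..<n} \<rightarrow>\<^sub>E P) - {{}}"
      using x X(2) by auto
  next
    fix X assume "X \<in> itinerary_cell M T n ` ({..<n} \<rightarrow>\<^sub>E P) - {{}}"
    then obtain x t where x: "x \<in> {..<n} \<rightarrow>\<^sub>E P" and X: "X = itinerary_cell M T n x" and t: "t \<in> X"
      by auto
    have tx: "t \<in> pre i (x i)" if "i < n" for i
      using t X that by (auto simp: itinerary_cell_def pre_def)
    define f where "f Q = (THE B. B \<in> Q \<and> t \<in> B)" for Q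
    have fx: "f (pre i ` P) = pre i (x i)" if "i < n" for i
      unfolding f_def
    proof (rule the_equality)
      show "pre i (x i) \<in> pre i ` P \<and> t \<in> pre i (x i)"
        using tx that x by auto
      fix B assume "B \<in> pre i ` P \<and> t \<in> B"
      thus "B = pre i (x i)"
        using tx[OF that] x that disj[of _ "x i" "(T ^^ i) t"] by (auto simp: pre_def PiE_iff)
    qed
    have "X = (\<Inter>i<n. pre i (x i))"
      unfolding X by (rule cell_eq)
    also have "\<dots> = (\<Inter>Q\<in>(\<lambda>i. pre i ` P) ` {..<n}. f Q)"
      using fx by auto
    finally show "X \<in> iterated_join M T P n"
      unfolding join common_refinement using fx x t by (intro DiffI UN_I[of f]) auto
  qed
qed

lemma partition_entropy_iterated_join:
  assumes P: "partition_on (space M) P" and "finite P"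
    and T: "\<And>t. t \<in> space M \<Longrightarrow> T t \<in> space M" and n: "1 \<le> n"
  shows "partition_entropy M (iterated_join M T P n) = itinerary_entropy M T P n"
proof -
  let ?c = "itinerary_cell M T n" and ?S = "{..<n} \<rightarrow>\<^sub>E P"
  let ?h = "\<lambda>A. measure M A * ln (measure M A)"
  have fin: "finite ?S" using assms by (intro finite_PiE) auto
  have inj: "inj_on ?c {x \<in> ?S. ?c x \<noteq> {}}"
  proof (rule inj_onI)
    fix x y assume "x \<in> {x \<in> ?S. ?c x \<noteq> {}}" "y \<in> {x \<in> ?S. ?c x \<noteq> {}}" and eq: "?c x = ?c y"
    hence xy: "x \<in> ?S" "y \<in> ?S" and "?c x \<noteq> {}" by auto
    then obtain t where t: "t \<in> ?c x" "t \<in> ?c y" using eq by auto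
    show "x = y"
    proof (rule PiE_ext[OF xy])
      fix i assume "i \<in> {..<n}"
      hence "(T ^^ i) t \<in> x i \<inter> y i" "x i \<in> P" "y i \<in> P"
        using t xy by (auto simp: itinerary_cell_def)
      thus "x i = y i"
        using P unfolding partition_on_def disjoint_def by blast
    qed
  qed
  have "(\<Sum>A\<in>iterated_join M T P n. ?h A) = (\<Sum>A\<in>?c ` {x \<in> ?S. ?c x \<noteq> {}}. ?h A)"
  proof (rule sum.cong)
    have "iterated_join M T P n = ?c ` ?S - {{}}"
      by (rule iterated_join_eq_cells) (use P T n in auto)
    thus "iterated_join M T P n = ?c ` {x \<in> ?S. ?c x \<noteq> {}}" by auto
  qed auto
  also have "\<dots> = (\<Sum>x\<in>{x \<in> ?S. ?c x \<noteq> {}}. ?h (?c x))"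
    by (simp add: sum.reindex[OF inj])
  also have "\<dots> = (\<Sum>x\<in>?S. ?h (?c x))"
    using fin by (intro sum.mono_neutral_left) auto
  finally show ?thesis
    by (simp add: partition_entropy_def itinerary_entropy_def)
qed

locale measure_preserving = prob_space M for M :: "'a measure" +
  fixes T :: "'a \<Rightarrow> 'a"
  assumes measurable_T [measurable]: "T \<in> measurable M M"
    and distr_T: "distr M M T = M"
begin

lemma measurable_iterate [measurable]: "(T ^^ i) \<in> measurable M M"
proof (induction i)
  case (Suc i)
  then show ?case by (auto simp: comp_def)
qed (auto simp: id_def[symmetric])

lemma distr_iterate: "distr M M (T ^^ i) = M"
proof (induction i)
  case 0
  show ?case by (simp add: distr_id2)
next
  case (Suc i)
  have "distr M M (T ^^ Suc i) = distr (distr M M (T ^^ i)) M T"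
    by (subst distr_distr) (auto simp: comp_def)
  with Suc show ?case by (simp only: distr_T)
qed

lemma integral_iterate:
  fixes f :: "'a \<Rightarrow> real"
  assumes [measurable]: "f \<in> borel_measurable M"
  shows "(\<integral>t. f ((T ^^ i) t) \<partial>M) = (\<integral>t. f t \<partial>M)"
  by (subst integral_distr[symmetric, of "T ^^ i" M M]) (auto simp: distr_iterate)

lemma integrable_iterate:
  fixes f :: "'a \<Rightarrow> real"
  assumes "integrable M f"
  shows "integrable M (\<lambda>t. f ((T ^^ i) t))"
  by (rule integrable_distr[of "T ^^ i" M M]) (auto simp: distr_iterate assms)

lemma measure_iterate_vimage:
  assumes [measurable]: "A \<in> sets M"
  shows "prob ((T ^^ i) -` A \<inter> space M) = prob A"
proof -
  have "prob A = measure (distr M M (T ^^ i)) A" by (simp add: distr_iterate)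
  thus ?thesis by (subst (asm) measure_distr) auto
qed

lemma iterate_space: "t \<in> space M \<Longrightarrow> (T ^^ i) t \<in> space M"
  by (rule measurable_space[OF measurable_iterate])

end

locale measure_preserving_partition = measure_preserving +
  fixes P :: "'a set set"
  assumes finite_P: "finite P" and sets_P: "P \<subseteq> sets M" and part_P: "partition_on (space M) P"
begin

abbreviation "cell \<equiv> itinerary_cell M T"

lemma finite_itineraries [simp]: "finite ({..<n::nat} \<rightarrow>\<^sub>E P)"
  using finite_P by (intro finite_PiE) auto

lemma sets_cell [simp]: "x \<in> {..<n} \<rightarrow>\<^sub>E P \<Longrightarrow> cell n x \<in> sets M"
proof -
  assume "x \<in> {..<n} \<rightarrow>\<^sub>E P"
  hence x: "x i \<in> sets M" if "i < n" for i using that sets_P by auto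
  have "{t \<in> space M. (T ^^ i) t \<in> x i} \<in> sets M" if "i < n" for i
    using measurable_sets[OF measurable_iterate x[OF that], of i] by (simp add: vimage_def Int_def conj_commute)
  hence "{t \<in> space M. \<forall>i\<in>{..<n}. (T ^^ i) t \<in> x i} \<in> sets M"
    by (intro sets.sets_Collect_finite_All) auto
  moreover have "cell n x = {t \<in> space M. \<forall>i\<in>{..<n}. (T ^^ i) t \<in> x i}"
    unfolding itinerary_cell_def by auto
  ultimately show ?thesis by (rule back_subst[of "\<lambda>A. A \<in> sets M", OF _ sym])
qed

lemma ex1_atom:
  assumes "t \<in> space M"
  shows "\<exists>!A. A \<in> P \<and> t \<in> A"
proof -
  obtain A where A: "A \<in> P" "t \<in> A"
    using assms partition_onD1[OF part_P] by blast
  show ?thesis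
  proof (rule ex1I[of _ A])
    fix B assume "B \<in> P \<and> t \<in> B"
    thus "B = A" using A disjointD[OF partition_onD2[OF part_P], of A B] by blast
  qed (use A in blast)
qed

lemma ex1_cell:
  assumes t: "t \<in> space M"
  shows "\<exists>!x. x \<in> {..<n} \<rightarrow>\<^sub>E P \<and> t \<in> cell n x"
proof -
  define w where "w i = (THE A. A \<in> P \<and> (T ^^ i) t \<in> A)" for i
  have w: "w i \<in> P \<and> (T ^^ i) t \<in> w i" for i
    unfolding w_def by (rule theI'[OF ex1_atom[OF iterate_space[OF t]]])
  show ?thesis
  proof (rule ex1I[of _ "restrict w {..<n}"])
    show "restrict w {..<n} \<in> {..<n} \<rightarrow>\<^sub>E P \<and> t \<in> cell n (restrict w {..<n})"
      using w t by (auto simp: itinerary_cell_def)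
    fix x assume x: "x \<in> {..<n} \<rightarrow>\<^sub>E P \<and> t \<in> cell n x"
    show "x = restrict w {..<n}"
    proof (rule extensionalityI[of _ "{..<n}"])
      fix i assume "i \<in> {..<n}"
      thus "x i = restrict w {..<n} i"
        using x w[of i] ex1_atom[OF iterate_space[OF t, of i]]
        by (auto simp: itinerary_cell_def PiE_iff)
    qed (use x in \<open>auto simp: PiE_iff\<close>)
  qed
qed

lemma sum_indicator_cell:
  fixes c :: "_ \<Rightarrow> real"
  assumes "t \<in> cell n x" "x \<in> {..<n} \<rightarrow>\<^sub>E P"
  shows "(\<Sum>y\<in>{..<n} \<rightarrow>\<^sub>E P. indicator (cell n y) t * c y) = c x"
proof -
  have t: "t \<in> space M" using assms by (auto simp: itinerary_cell_def)
  have "(\<Sum>y\<in>{..<n} \<rightarrow>\<^sub>E P. indicator (cell n y) t * c y)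
      = (\<Sum>y\<in>{..<n} \<rightarrow>\<^sub>E P. if y = x then c y else 0)"
    using ex1_cell[OF t, of n] assms by (intro sum.cong) (auto simp: indicator_def)
  thus ?thesis using assms by (simp add: sum.delta)
qed

lemma integral_sum_cell:
  fixes c :: "_ \<Rightarrow> real"
  shows "integrable M (\<lambda>t. \<Sum>y\<in>{..<n} \<rightarrow>\<^sub>E P. indicator (cell n y) t * c y)"
    and "(\<integral>t. (\<Sum>y\<in>{..<n} \<rightarrow>\<^sub>E P. indicator (cell n y) t * c y) \<partial>M)
      = (\<Sum>y\<in>{..<n} \<rightarrow>\<^sub>E P. prob (cell n y) * c y)"
proof -
  have i: "integrable M (\<lambda>t. indicator (cell n y) t * c y)" if "y \<in> {..<n} \<rightarrow>\<^sub>E P" for y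
    using that by (intro integrable_mult_left) (auto simp: less_top[symmetric])
  show "integrable M (\<lambda>t. \<Sum>y\<in>{..<n} \<rightarrow>\<^sub>E P. indicator (cell n y) t * c y)"
    using i by (rule Bochner_Integration.integrable_sum)
  show "(\<integral>t. (\<Sum>y\<in>{..<n} \<rightarrow>\<^sub>E P. indicator (cell n y) t * c y) \<partial>M)
      = (\<Sum>y\<in>{..<n} \<rightarrow>\<^sub>E P. prob (cell n y) * c y)"
    using i by (subst Bochner_Integration.integral_sum)
      (auto intro!: sum.cong simp: sets.Int_space_eq2)
qed

lemma sum_prob_cell: "(\<Sum>y\<in>{..<n::nat} \<rightarrow>\<^sub>E P. prob (cell n y)) = 1"
proof -
  have "(\<integral>t. (\<Sum>y\<in>{..<n} \<rightarrow>\<^sub>E P. indicator (cell n y) t * (1::real)) \<partial>M) = (\<integral>t. 1 \<partial>M)"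
  proof (intro Bochner_Integration.integral_cong refl)
    fix t assume t: "t \<in> space M"
    obtain x where x: "x \<in> {..<n} \<rightarrow>\<^sub>E P" "t \<in> cell n x" using ex1_cell[OF t, of n] by auto
    show "(\<Sum>y\<in>{..<n} \<rightarrow>\<^sub>E P. indicator (cell n y) t * 1) = (1::real)"
      by (rule sum_indicator_cell[OF x(2,1)])
  qed
  thus ?thesis using integral_sum_cell(2)[of n "\<lambda>_. 1"] by (simp add: prob_space)
qed

text \<open>
  Gibbs' inequality in the form used below: it suffices to bound \<open>ln g\<close> from below pointwise, by a
  function \<open>F\<close> of the point rather than of its itinerary. Cells of measure zero are exempt, so that
  \<open>g\<close> may itself be built from measures of cells.
\<close>

lemma itinerary_entropy_le:
  assumes g0: "\<And>x. x \<in> {..<n} \<rightarrow>\<^sub>E P \<Longrightarrow> 0 \<le> g x"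
    and g1: "(\<Sum>x\<in>{..<n} \<rightarrow>\<^sub>E P. g x) \<le> 1"
    and F: "integrable M F"
    and gF: "\<And>x t. \<lbrakk>x \<in> {..<n} \<rightarrow>\<^sub>E P; t \<in> cell n x; 0 < prob (cell n x)\<rbrakk> \<Longrightarrow> 0 < g x \<and> F t \<le> ln (g x)"
  shows "itinerary_entropy M T P n \<le> - (\<integral>t. F t \<partial>M)"
proof -
  have "itinerary_entropy M T P n \<le> - (\<Sum>x\<in>{..<n} \<rightarrow>\<^sub>E P. prob (cell n x) * ln (g x))"
    unfolding itinerary_entropy_def
  proof (rule neg_sum_mult_ln_le)
    fix x assume x: "x \<in> {..<n} \<rightarrow>\<^sub>E P" and p: "0 < prob (cell n x)"
    hence "cell n x \<noteq> {}" by auto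
    thus "0 < g x" using gF[OF x _ p] by auto
  qed (use g0 g1 sum_prob_cell in auto)
  moreover have "(\<integral>t. F t \<partial>M) \<le> (\<integral>t. (\<Sum>x\<in>{..<n} \<rightarrow>\<^sub>E P. indicator (cell n x) t * ln (g x)) \<partial>M)"
  proof (rule integral_mono_AE[OF F integral_sum_cell(1)])
    have "AE t in M. t \<notin> cell n x" if "x \<in> {..<n} \<rightarrow>\<^sub>E P" "prob (cell n x) = 0" for x
      using that by (intro AE_not_in) (auto simp: null_sets_def emeasure_eq_measure)
    hence "AE t in M. \<forall>x\<in>{x\<in>{..<n} \<rightarrow>\<^sub>E P. prob (cell n x) = 0}. t \<notin> cell n x"
      by (intro AE_finite_allI) auto
    thus "AE t in M. F t \<le> (\<Sum>x\<in>{..<n} \<rightarrow>\<^sub>E P. indicator (cell n x) t * ln (g x))"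
      using AE_space
    proof eventually_elim
      case (elim t)
      obtain x where x: "x \<in> {..<n} \<rightarrow>\<^sub>E P" "t \<in> cell n x" using ex1_cell[of t n] elim(2) by blast
      moreover have "prob (cell n x) > 0"
        using elim(1) x by (auto simp: order.strict_iff_order)
      ultimately show ?case using gF[of x t] by (subst sum_indicator_cell[OF x(2,1)]) auto
    qed
  qed
  ultimately show ?thesis unfolding integral_sum_cell(2) by linarith
qed

text \<open>
  Here \<open>g\<close> is the product of the laws of the first \<open>n\<close> and of the next \<open>k\<close> entries of an itinerary;
  by invariance the second one is the law of an itinerary of length \<open>k\<close>.
\<close>

lemma itinerary_entropy_subadditive:
  "itinerary_entropy M T P (n + k) \<le> itinerary_entropy M T P n + itinerary_entropy M T P k"
proof -
  define G where "G j t = (\<Sum>y\<in>{..<j} \<rightarrow>\<^sub>E P. indicator (cell j y) t * ln (prob (cell j y)))" for j t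
  define hd where "hd x = restrict x {..<n}" for x :: "nat \<Rightarrow> 'a set"
  define tl where "tl x = (\<lambda>i\<in>{..<k}. x (n + i))" for x :: "nat \<Rightarrow> 'a set"
  have iG: "integrable M (G j)" "(\<integral>t. G j t \<partial>M) = - itinerary_entropy M T P j" for j
    unfolding G_def itinerary_entropy_def integral_sum_cell(2) by (rule integral_sum_cell(1), simp)
  have hdtl: "hd x \<in> {..<n} \<rightarrow>\<^sub>E P" "tl x \<in> {..<k} \<rightarrow>\<^sub>E P" if "x \<in> {..<n + k} \<rightarrow>\<^sub>E P" for x
    using that by (auto simp: hd_def tl_def)
  have cell: "cell (n + k) x \<subseteq> cell n (hd x)"
    "cell (n + k) x \<subseteq> (T ^^ n) -` cell k (tl x) \<inter> space M" for x
    using iterate_space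
    by (auto simp: itinerary_cell_def hd_def tl_def) (metis add.commute funpow_add comp_apply nat_add_left_cancel_less)
  have "itinerary_entropy M T P (n + k) \<le> - (\<integral>t. G n t + G k ((T ^^ n) t) \<partial>M)"
  proof (rule itinerary_entropy_le[where g = "\<lambda>x. prob (cell n (hd x)) * prob (cell k (tl x))"])
    show "(\<Sum>x\<in>{..<n + k} \<rightarrow>\<^sub>E P. prob (cell n (hd x)) * prob (cell k (tl x))) \<le> 1"
      unfolding hd_def tl_def by (subst sum_PiE_split) (simp add: sum_prob_cell)
  next
    fix x t assume x: "x \<in> {..<n + k} \<rightarrow>\<^sub>E P" and t: "t \<in> cell (n + k) x" and p: "0 < prob (cell (n + k) x)"
    have "prob (cell (n + k) x) \<le> prob (cell n (hd x))"
      using hdtl[OF x] cell by (intro finite_measure_mono) auto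
    moreover have "prob (cell (n + k) x) \<le> prob ((T ^^ n) -` cell k (tl x) \<inter> space M)"
      using hdtl[OF x] cell by (intro finite_measure_mono measurable_sets[OF measurable_iterate]) auto
    ultimately have pos: "0 < prob (cell n (hd x))" "0 < prob (cell k (tl x))"
      using hdtl[OF x] p by (auto simp: measure_iterate_vimage)
    have "t \<in> cell n (hd x)" "(T ^^ n) t \<in> cell k (tl x)"
      using cell[of x] t by (blast, blast)
    from sum_indicator_cell[OF this(1) hdtl(1)[OF x]] sum_indicator_cell[OF this(2) hdtl(2)[OF x]]
    have "G n t = ln (prob (cell n (hd x)))" "G k ((T ^^ n) t) = ln (prob (cell k (tl x)))"
      unfolding G_def by (simp_all only:)
    thus "0 < prob (cell n (hd x)) * prob (cell k (tl x)) \<and>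
      G n t + G k ((T ^^ n) t) \<le> ln (prob (cell n (hd x)) * prob (cell k (tl x)))"
      using pos by (simp add: ln_mult)
  qed (use iG in \<open>auto intro!: integrable_iterate Bochner_Integration.integrable_add\<close>)
  also have "\<dots> = - ((\<integral>t. G n t \<partial>M) + (\<integral>t. G k ((T ^^ n) t) \<partial>M))"
    using iG by (subst Bochner_Integration.integral_add) (auto intro!: integrable_iterate)
  also have "\<dots> = itinerary_entropy M T P n + itinerary_entropy M T P k"
    using iG by (subst integral_iterate) auto
  finally show ?thesis .
qed

lemma itinerary_entropy_nonneg: "0 \<le> itinerary_entropy M T P n"
proof -
  have "prob A * ln (prob A) \<le> 0" for A
    by (cases "prob A = 0") (auto intro!: mult_nonneg_nonpos simp: less_le)
  thus ?thesis
    unfolding itinerary_entropy_def by (simp add: sum_nonpos)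
qed

text \<open>
  The entropy is defined by the operator \<open>lim\<close>, about which nothing is known unless the sequence
  converges; this lemma is what makes the definition usable.
\<close>

lemma entropy_wrt_partition_LIMSEQ:
  "(\<lambda>n. itinerary_entropy M T P n / real n) \<longlonglongrightarrow> entropy_wrt_partition M T P"
proof -
  have "convergent (\<lambda>n. itinerary_entropy M T P n / real n)"
    by (intro subadditive_imp_convergent itinerary_entropy_nonneg itinerary_entropy_subadditive)
  then obtain L where L: "(\<lambda>n. itinerary_entropy M T P n / real n) \<longlonglongrightarrow> L"
    by (auto simp: convergent_def)
  have "\<forall>\<^sub>F n in sequentially. itinerary_entropy M T P n / real n
      = partition_entropy M (iterated_join M T P n) / real n"
    using iterate_space[of _ 1]
    by (intro eventually_sequentiallyI[of 1])
       (simp add: partition_entropy_iterated_join[OF part_P finite_P])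
  with L have "(\<lambda>n. partition_entropy M (iterated_join M T P n) / real n) \<longlonglongrightarrow> L"
    by (rule Lim_transform_eventually)
  hence "entropy_wrt_partition M T P = L"
    unfolding entropy_wrt_partition_def by (rule limI)
  with L show ?thesis by simp
qed

lemma entropy_wrt_partition_nonneg: "0 \<le> entropy_wrt_partition M T P"
  by (rule LIMSEQ_le_const[OF entropy_wrt_partition_LIMSEQ])
     (auto intro!: exI[of _ 0] divide_nonneg_nonneg itinerary_entropy_nonneg)

end

section \<open>Borel sets of a topology\<close>

lemma openin_subset_Pow_topspace: "{U. openin X U} \<subseteq> Pow (topspace X)"
  using openin_subset by auto

lemma sets_borel_of: "sets (borel_of X) = sigma_sets (topspace X) {U. openin X U}"
  unfolding borel_of_def by (rule sets_measure_of[OF openin_subset_Pow_topspace])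

lemma space_borel_of: "space (borel_of X) = topspace X"
  unfolding borel_of_def by (rule space_measure_of[OF openin_subset_Pow_topspace])

lemma closedin_imp_borel: "closedin X S \<Longrightarrow> S \<in> sets (borel_of X)"
proof -
  assume S: "closedin X S"
  hence "topspace X - S \<in> sets (borel_of X)"
    unfolding sets_borel_of by (intro sigma_sets.Basic) (auto simp: closedin_def)
  from sets.compl_sets[OF this] show ?thesis
    using closedin_subset[OF S] by (simp add: space_borel_of double_diff)
qed

lemma continuous_map_indicator_clopen:
  assumes "openin X C" "closedin X C"
  shows "continuous_map X euclideanreal (indicator C)"
proof -
  have "openin X {x \<in> topspace X. indicat_real C x \<in> U}" for U
  proof -
    have "{x \<in> topspace X. indicat_real C x \<in> U}
      = (if 1 \<in> U then C else {}) \<union> (if 0 \<in> U then topspace X - C else {})"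
      using openin_subset[OF assms(1)] by (auto simp: indicator_def)
    thus ?thesis using assms by (auto simp: openin_diff)
  qed
  thus ?thesis by (simp add: continuous_map)
qed

section \<open>Topology and measures on the shift space\<close>

text \<open>
  The arguments range over all functions and not only over the points of the shift space, since such
  functions are also evaluated at concatenations of finitely many words, which have no meaningful
  digits beyond the last word.
\<close>

definition determined_by_prefix :: "nat \<Rightarrow> ((nat \<Rightarrow> nat) \<Rightarrow> 'b) \<Rightarrow> bool" where
  "determined_by_prefix q f \<longleftrightarrow> (\<forall>t t'. (\<forall>j\<in>{1..q}. t j = t' j) \<longrightarrow> f t = f t')"

lemma determined_by_prefixD:
  "\<lbrakk>determined_by_prefix q f; \<And>j. \<lbrakk>1 \<le> j; j \<le> q\<rbrakk> \<Longrightarrow> t j = t' j\<rbrakk> \<Longrightarrow> f t = f t'"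
  unfolding determined_by_prefix_def by auto

lemma determined_by_prefix_mono:
  "\<lbrakk>determined_by_prefix q f; q \<le> q'\<rbrakk> \<Longrightarrow> determined_by_prefix q' f"
  unfolding determined_by_prefix_def by auto

lemma determined_by_prefix_comp:
  "determined_by_prefix q f \<Longrightarrow> determined_by_prefix q (\<lambda>t. h (f t))"
  unfolding determined_by_prefix_def by metis

lemma openin_determined_by_prefix:
  assumes B: "determined_by_prefix q (\<lambda>t. t \<in> B)"
  shows "openin (shift_top m) (B \<inter> shift_space m)"
proof (subst openin_subopen, intro ballI)
  fix t assume t: "t \<in> B \<inter> shift_space m"
  define X where "X j = (if j \<in> {1..q} then {t j} else {..<m})" for j
  have "openin (shift_top m) (Pi\<^sub>E {1..} X)"
    unfolding shift_top_def
  proof (rule product_topology_basis)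
    show "openin (discrete_topology {..<m}) (X i)" for i
      using t by (auto simp: X_def shift_space_def PiE_iff)
    have "{i. X i \<noteq> topspace (discrete_topology {..<m})} \<subseteq> {1..q}"
      by (auto simp: X_def)
    thus "finite {i. X i \<noteq> topspace (discrete_topology {..<m})}"
      by (rule finite_subset) auto
  qed
  moreover have "t \<in> Pi\<^sub>E {1..} X"
    using t by (auto simp: X_def shift_space_def PiE_iff)
  moreover have "Pi\<^sub>E {1..} X \<subseteq> B \<inter> shift_space m"
  proof
    fix t' assume t': "t' \<in> Pi\<^sub>E {1..} X"
    have "t' \<in> shift_space m"
      unfolding shift_space_def
    proof (rule PiE_I)
      fix i :: nat assume i: "i \<in> {1..}"
      have "t i < m" using t i by (auto simp: shift_space_def PiE_iff)
      thus "t' i \<in> {..<m}" using PiE_mem[OF t' i] by (auto simp: X_def split: if_splits)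
    qed (use PiE_arb[OF t'] in auto)
    moreover have "t' j = t j" if "1 \<le> j" "j \<le> q" for j
      using PiE_mem[OF t', of j] that by (auto simp: X_def)
    hence "t' \<in> B" using determined_by_prefixD[OF B, of t' t] t by auto
    ultimately show "t' \<in> B \<inter> shift_space m" by blast
  qed
  ultimately show "\<exists>U. openin (shift_top m) U \<and> t \<in> U \<and> U \<subseteq> B \<inter> shift_space m" by blast
qed

lemma openin_contains_cylinder:
  assumes U: "openin (shift_top m) U" and t: "t \<in> U"
  obtains q where "\<And>t'. \<lbrakk>t' \<in> shift_space m; \<And>j. \<lbrakk>1 \<le> j; j \<le> q\<rbrakk> \<Longrightarrow> t j = t' j\<rbrakk> \<Longrightarrow> t' \<in> U"
proof -
  obtain X where X: "t \<in> Pi\<^sub>E {1..} X" "finite {i. X i \<noteq> {..<m}}" "Pi\<^sub>E {1..} X \<subseteq> U"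
    using product_topology_open_contains_basis[OF U[unfolded shift_top_def] t] by auto
  obtain q where q: "\<And>i. X i \<noteq> {..<m} \<Longrightarrow> i \<le> q"
    using finite_nat_set_iff_bounded_le[THEN iffD1, OF X(2)] by auto
  show ?thesis
  proof
    fix t' assume t': "t' \<in> shift_space m" and agree: "\<And>j. \<lbrakk>1 \<le> j; j \<le> q\<rbrakk> \<Longrightarrow> t j = t' j"
    have "t' \<in> Pi\<^sub>E {1..} X"
    proof (rule PiE_I)
      fix i :: nat assume i: "i \<in> {1..}"
      show "t' i \<in> X i"
      proof (cases "i \<le> q")
        case True
        thus ?thesis using agree[of i] PiE_mem[OF X(1) i] i by auto
      next
        case False
        hence "X i = {..<m}" using q by blast
        thus ?thesis using t' i by (auto simp: shift_space_def PiE_iff)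
      qed
    next
      fix i :: nat assume "i \<notin> {1..}"
      thus "t' i = undefined" using t' unfolding shift_space_def by (metis PiE_arb)
    qed
    thus "t' \<in> U" using X(3) by blast
  qed
qed

lemma shift_in_shift_space: "t \<in> shift_space m \<Longrightarrow> shift t \<in> shift_space m"
  unfolding shift_def shift_space_def by (intro restrict_PiE_iff[THEN iffD2]) (auto dest: PiE_mem)

lemma funpow_shift_in_shift_space: "t \<in> shift_space m \<Longrightarrow> (shift ^^ i) t \<in> shift_space m"
  by (induction i) (auto simp: shift_in_shift_space)

lemma funpow_shift_apply: "1 \<le> j \<Longrightarrow> (shift ^^ i) t j = t (i + j)"
  by (induction i arbitrary: j) (auto simp: shift_def)

lemma continuous_map_digit:
  "1 \<le> j \<Longrightarrow> continuous_map (shift_top m) (discrete_topology {..<m}) (\<lambda>t. t j)"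
  unfolding shift_top_def by (rule continuous_map_product_projection) auto

lemma continuous_map_shift: "continuous_map (shift_top m) (shift_top m) shift"
proof -
  have "continuous_map (shift_top m) (discrete_topology {..<m}) (\<lambda>t. shift t k)" if "k \<in> {1..}" for k
    using continuous_map_digit[of "k + 1" m] that by (simp add: shift_def)
  moreover have "shift ` topspace (shift_top m) \<subseteq> extensional {1..}"
    by (auto simp: shift_def)
  ultimately have "continuous_map (shift_top m) (product_topology (\<lambda>_. discrete_topology {..<m}) {1..}) shift"
    unfolding continuous_map_componentwise by blast
  thus ?thesis by (simp only: shift_top_def[symmetric])
qed

definition cylinder :: "nat \<Rightarrow> nat \<Rightarrow> (nat \<Rightarrow> nat) \<Rightarrow> (nat \<Rightarrow> nat) set" where
  "cylinder m l \<epsilon> = {t \<in> shift_space m. \<forall>j\<in>{1..l}. t j = \<epsilon> j}"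

lemma openin_cylinder: "openin (shift_top m) (cylinder m l \<epsilon>)"
proof -
  have "determined_by_prefix l (\<lambda>t. t \<in> {t. \<forall>j\<in>{1..l}. t j = \<epsilon> j})"
    by (simp add: determined_by_prefix_def)
  from openin_determined_by_prefix[OF this] show ?thesis
    by (simp only: cylinder_def Int_def mem_Collect_eq conj_commute)
qed

lemma closedin_cylinder: "closedin (shift_top m) (cylinder m l \<epsilon>)"
proof -
  have "determined_by_prefix l (\<lambda>t. t \<in> {t. \<not> (\<forall>j\<in>{1..l}. t j = \<epsilon> j)})"
    by (simp add: determined_by_prefix_def)
  from openin_determined_by_prefix[OF this]
  have "openin (shift_top m) ({t. \<not> (\<forall>j\<in>{1..l}. t j = \<epsilon> j)} \<inter> shift_space m)" .
  moreover have "{t. \<not> (\<forall>j\<in>{1..l}. t j = \<epsilon> j)} \<inter> shift_space m = shift_space m - cylinder m l \<epsilon>"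
    by (auto simp: cylinder_def)
  ultimately show ?thesis by (auto simp: closedin_def cylinder_def)
qed

context
  fixes m :: nat and \<nu> :: "(nat \<Rightarrow> nat) measure"
  assumes \<nu>: "\<nu> \<in> invariant_measures m"
begin

lemma sets_invariant: "sets \<nu> = sigma_sets (shift_space m) {U. openin (shift_top m) U}"
  using \<nu> by (simp add: invariant_measures_def sets_borel_of)

lemma space_invariant: "space \<nu> = shift_space m"
proof -
  have "space \<nu> = space (borel_of (shift_top m))"
    using \<nu> by (intro sets_eq_imp_space_eq) (simp add: invariant_measures_def)
  thus ?thesis by (simp add: space_borel_of)
qed

lemma openin_sets: "openin (shift_top m) U \<Longrightarrow> U \<in> sets \<nu>"
  unfolding sets_invariant by (rule sigma_sets.Basic) simp

lemma determined_by_prefix_sets: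
  assumes "determined_by_prefix q (\<lambda>t. t \<in> B)"
  shows "{t \<in> space \<nu>. t \<in> B} \<in> sets \<nu>"
  using openin_sets[OF openin_determined_by_prefix[OF assms]]
  by (simp only: Int_def space_invariant conj_commute)

lemma measure_preserving_shift: "measure_preserving \<nu> shift"
proof -
  interpret prob_space \<nu>
    using \<nu> by (intro prob_spaceI) (simp add: invariant_measures_def)
  have meas: "shift \<in> measurable \<nu> \<nu>"
  proof (rule measurable_sigma_sets[OF sets_invariant])
    show "{U. openin (shift_top m) U} \<subseteq> Pow (shift_space m)"
      using openin_subset_Pow_topspace[of "shift_top m"] by simp
    show "shift \<in> space \<nu> \<rightarrow> shift_space m"
      by (auto simp: space_invariant shift_in_shift_space)
    fix U assume "U \<in> {U. openin (shift_top m) U}"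
    hence "openin (shift_top m) {t \<in> topspace (shift_top m). shift t \<in> U}"
      by (intro openin_continuous_map_preimage[OF continuous_map_shift]) simp
    moreover have "{t \<in> topspace (shift_top m). shift t \<in> U} = shift -` U \<inter> space \<nu>"
      by (auto simp: space_invariant)
    ultimately show "shift -` U \<inter> space \<nu> \<in> sets \<nu>"
      using openin_sets by metis
  qed
  show ?thesis
  proof
    show "distr \<nu> \<nu> shift = \<nu>"
    proof (rule measure_eqI)
      fix A assume "A \<in> sets (distr \<nu> \<nu> shift)"
      hence "A \<in> sets \<nu>" by simp
      thus "emeasure (distr \<nu> \<nu> shift) A = emeasure \<nu> A"
        using meas \<nu> by (simp add: emeasure_distr invariant_measures_def)
    qed simp
  qed (rule meas)
qed

interpretation measure_preserving \<nu> shift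
  by (rule measure_preserving_shift)

lemma sets_mismatch:
  assumes "A \<in> sets \<nu>" "determined_by_prefix q (\<lambda>t. t \<in> B)"
  shows "{t \<in> space \<nu>. (t \<in> A) \<noteq> (t \<in> B)} \<in> sets \<nu>"
proof -
  have "{t \<in> space \<nu>. (t \<in> A) \<noteq> (t \<in> B)}
      = (A - {t \<in> space \<nu>. t \<in> B}) \<union> ({t \<in> space \<nu>. t \<in> B} - A)"
    using sets.sets_into_space[OF assms(1)] by auto
  thus ?thesis using assms determined_by_prefix_sets[OF assms(2)] by auto
qed

text \<open>
  An open set is the increasing union over \<open>q\<close> of the unions of the cylinders of length \<open>q\<close> that it
  contains.
\<close>

lemma ex_prefix_approximation_open:
  assumes U: "openin (shift_top m) U" and e: "0 < e"
  shows "\<exists>q B. determined_by_prefix q (\<lambda>t. t \<in> B) \<and> prob {t \<in> space \<nu>. (t \<in> U) \<noteq> (t \<in> B)} < e"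
proof -
  \<comment> \<open>\<open>V q\<close> is the union of the cylinders of length \<open>q\<close> contained in \<open>U\<close>.\<close>
  define B where "B q = {t. \<forall>t'\<in>shift_space m. (\<forall>j\<in>{1..q}. t j = t' j) \<longrightarrow> t' \<in> U}" for q
  define V where "V q = {t \<in> space \<nu>. t \<in> B q}" for q
  have B: "determined_by_prefix q (\<lambda>t. t \<in> B q)" for q
    unfolding determined_by_prefix_def B_def by simp
  have V: "range V \<subseteq> sets \<nu>"
    unfolding V_def using determined_by_prefix_sets[OF B] by blast
  have "incseq V"
    unfolding V_def B_def by (rule incseq_SucI) force
  have VU: "V q \<subseteq> U" for q
    by (auto simp: V_def B_def space_invariant)
  have "(\<Union>q. V q) = U"
  proof
    show "U \<subseteq> (\<Union>q. V q)"
    proof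
      fix t assume t: "t \<in> U"
      obtain q where "\<And>t'. \<lbrakk>t' \<in> shift_space m; \<And>j. \<lbrakk>1 \<le> j; j \<le> q\<rbrakk> \<Longrightarrow> t j = t' j\<rbrakk> \<Longrightarrow> t' \<in> U"
        using openin_contains_cylinder[OF U t] by blast
      hence "t \<in> V q" using t openin_subset[OF U] by (auto simp: V_def B_def space_invariant)
      thus "t \<in> (\<Union>q. V q)" by blast
    qed
  qed (use VU in blast)
  hence "(\<lambda>q. prob (V q)) \<longlonglongrightarrow> prob U"
    using finite_Lim_measure_incseq[OF V \<open>incseq V\<close>] by simp
  from LIMSEQ_D[OF this e] obtain q where q: "norm (prob (V q) - prob U) < e" by blast
  have "{t \<in> space \<nu>. (t \<in> U) \<noteq> (t \<in> B q)} = U - V q"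
    using VU[of q] sets.sets_into_space[OF openin_sets[OF U]] by (auto simp: V_def)
  moreover have "prob (U - V q) = prob U - prob (V q)"
    using V VU openin_sets[OF U] by (intro finite_measure_Diff) auto
  ultimately have "prob {t \<in> space \<nu>. (t \<in> U) \<noteq> (t \<in> B q)} < e"
    using q by (simp add: abs_less_iff)
  thus ?thesis using B by blast
qed

text \<open>
  The sets that can be approximated by sets determined by finitely many digits contain the open sets and are
  closed under complements and countable unions.
\<close>

lemma ex_prefix_approximation:
  assumes A: "A \<in> sets \<nu>" and e: "0 < e"
  shows "\<exists>q B. determined_by_prefix q (\<lambda>t. t \<in> B) \<and> prob {t \<in> space \<nu>. (t \<in> A) \<noteq> (t \<in> B)} < e"
proof -
  have "A \<in> sigma_sets (shift_space m) {U. openin (shift_top m) U}"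
    using A by (simp only: sets_invariant)
  thus ?thesis using e
  proof (induction arbitrary: e)
    case (Basic U)
    thus ?case using ex_prefix_approximation_open by blast
  next
    case Empty
    show ?case
      by (rule exI[of _ 0], rule exI[of _ "{}"]) (use Empty in \<open>simp add: determined_by_prefix_def\<close>)
  next
    case (Compl A)
    then obtain q B where B: "determined_by_prefix q (\<lambda>t. t \<in> B)"
      "prob {t \<in> space \<nu>. (t \<in> A) \<noteq> (t \<in> B)} < e" by blast
    have "{t \<in> space \<nu>. (t \<in> shift_space m - A) \<noteq> (t \<in> - B)} = {t \<in> space \<nu>. (t \<in> A) \<noteq> (t \<in> B)}"
      by (auto simp: space_invariant)
    moreover have "determined_by_prefix q (\<lambda>t. t \<in> - B)"
      using determined_by_prefix_comp[OF B(1), of Not] by simp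
    moreover note B(2)
    ultimately show ?case by (intro exI[of _ q] exI[of _ "- B"]) (simp only: simp_thms)
  next
    case (Union A)
    have sA: "A i \<in> sets \<nu>" for i using Union(1) by (simp only: sets_invariant)
    define S where "S N = (\<Union>i<N. A i)" for N
    have sS: "range S \<subseteq> sets \<nu>" unfolding S_def using sA by (intro image_subsetI sets.finite_UN) auto
    have "incseq S" unfolding S_def incseq_def by (intro allI impI UN_mono) auto
    have "(\<Union>N. S N) = (\<Union>i. A i)" unfolding S_def by blast
    hence "(\<lambda>N. prob (S N)) \<longlonglongrightarrow> prob (\<Union>i. A i)"
      using finite_Lim_measure_incseq[OF sS \<open>incseq S\<close>] by simp
    from LIMSEQ_D[OF this, of "e / 2"] Union(3)
    obtain N where N: "norm (prob (S N) - prob (\<Union>i. A i)) < e / 2" by force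
    \<comment> \<open>The first \<open>N\<close> sets exhaust the union up to \<open>e / 2\<close>; each of them is approximated up to \<open>d\<close>.\<close>
    define d where "d = e / (2 * (real N + 1))"
    have "0 < d" using Union(3) by (simp add: d_def)
    define R where "R i q B \<longleftrightarrow> determined_by_prefix q (\<lambda>t. t \<in> B) \<and>
      prob {t \<in> space \<nu>. (t \<in> A i) \<noteq> (t \<in> B)} < d" for i q B
    have "\<forall>i. \<exists>q B. R i q B"
      unfolding R_def by (intro allI Union(2) \<open>0 < d\<close>)
    then obtain q B where "\<And>i. R i (q i) (B i)" by metis
    hence B: "\<And>i. determined_by_prefix (q i) (\<lambda>t. t \<in> B i)"
      "\<And>i. prob {t \<in> space \<nu>. (t \<in> A i) \<noteq> (t \<in> B i)} < d"
      unfolding R_def by auto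
    define E where "E i = {t \<in> space \<nu>. (t \<in> A i) \<noteq> (t \<in> B i)}" for i
    have sE: "E i \<in> sets \<nu>" for i
      unfolding E_def by (rule sets_mismatch[OF sA B(1)])
    define Q where "Q = (\<Sum>i<N. q i)"
    have det: "determined_by_prefix Q (\<lambda>t. t \<in> (\<Union>i<N. B i))"
    proof -
      have "determined_by_prefix Q (\<lambda>t. t \<in> B i)" if "i < N" for i
        using that by (intro determined_by_prefix_mono[OF B(1)[of i]])
          (auto simp: Q_def intro!: member_le_sum)
      thus ?thesis unfolding determined_by_prefix_def by (simp only: UN_iff) blast
    qed
    have "{t \<in> space \<nu>. (t \<in> (\<Union>i. A i)) \<noteq> (t \<in> (\<Union>i<N. B i))} \<subseteq> ((\<Union>i. A i) - S N) \<union> (\<Union>i<N. E i)"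
      unfolding S_def E_def by blast
    hence "prob {t \<in> space \<nu>. (t \<in> (\<Union>i. A i)) \<noteq> (t \<in> (\<Union>i<N. B i))}
        \<le> prob (((\<Union>i. A i) - S N) \<union> (\<Union>i<N. E i))"
      using sA sS sE by (intro finite_measure_mono) auto
    also have "\<dots> \<le> prob ((\<Union>i. A i) - S N) + prob (\<Union>i<N. E i)"
      using sA sS sE by (intro measure_Un_le) auto
    also have "prob ((\<Union>i. A i) - S N) = prob (\<Union>i. A i) - prob (S N)"
      using sA sS by (intro finite_measure_Diff) (auto simp: S_def)
    also have "\<dots> < e / 2" using N unfolding real_norm_def by linarith
    also have "prob (\<Union>i<N. E i) \<le> (\<Sum>i<N. prob (E i))"
      using sE by (intro finite_measure_subadditive_finite) auto
    also have "\<dots> \<le> (\<Sum>i<N. d)"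
      using B(2) by (intro sum_mono) (simp add: E_def less_imp_le)
    also have "\<dots> \<le> e / 2"
      using Union(3) by (simp add: d_def field_simps)
    finally show ?case using det by (intro exI[of _ Q] exI[of _ "\<Union>i<N. B i"]) simp
  qed
qed

text \<open>
  Each atom \<open>A\<close> is replaced by a set \<open>B A\<close> determined by a prefix, and \<open>\<phi>\<close> selects an atom \<open>A\<close> with
  \<open>t \<in> B A\<close>. The selection is right unless \<open>t\<close> lies in the symmetric difference of some \<open>A\<close> and \<open>B A\<close>.
\<close>

lemma ex_prefix_partition_approximation:
  assumes P: "finite P" "P \<subseteq> sets \<nu>" "partition_on (space \<nu>) P" and e: "0 < e"
  obtains q \<phi> where "determined_by_prefix q \<phi>" "\<And>t. \<phi> t \<in> P"
    "{t \<in> space \<nu>. t \<notin> \<phi> t} \<in> sets \<nu>" "prob {t \<in> space \<nu>. t \<notin> \<phi> t} < e"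
proof -
  have "P \<noteq> {}" using P(3) not_empty by (auto simp: partition_on_def)
  then obtain A0 where A0: "A0 \<in> P" by blast
  have card: "0 < card P" using P(1) \<open>P \<noteq> {}\<close> by (simp add: card_gt_0_iff)
  define d where "d = e / real (card P)"
  have d: "0 < d" using card e by (simp add: d_def)
  define R where "R A q B \<longleftrightarrow> determined_by_prefix q (\<lambda>t. t \<in> B) \<and>
    prob {t \<in> space \<nu>. (t \<in> A) \<noteq> (t \<in> B)} < d" for A q B
  have "\<forall>A\<in>P. \<exists>q B. R A q B"
    unfolding R_def by (intro ballI ex_prefix_approximation d) (use P(2) in blast)
  then obtain q B where "\<And>A. A \<in> P \<Longrightarrow> R A (q A) (B A)" by metis
  hence B: "\<And>A. A \<in> P \<Longrightarrow> determined_by_prefix (q A) (\<lambda>t. t \<in> B A)"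
      "\<And>A. A \<in> P \<Longrightarrow> prob {t \<in> space \<nu>. (t \<in> A) \<noteq> (t \<in> B A)} < d"
    unfolding R_def by auto
  define Q where "Q = (\<Sum>A\<in>P. q A)"
  \<comment> \<open>The value \<open>A0\<close> for the empty set makes \<open>\<phi>\<close> take values in \<open>P\<close> everywhere.\<close>
  define pick where "pick X = (if X = {} then A0 else SOME A. A \<in> X)" for X :: "(nat \<Rightarrow> nat) set set"
  define \<phi> where "\<phi> t = pick {A \<in> P. t \<in> B A}" for t
  define E where "E A = {t \<in> space \<nu>. (t \<in> A) \<noteq> (t \<in> B A)}" for A
  have pick: "pick X \<in> X" if "X \<noteq> {}" for X
    using that some_in_eq[of X] by (simp add: pick_def)
  have \<phi>P: "\<phi> t \<in> P" for t
    using A0 pick[of "{A \<in> P. t \<in> B A}"] by (cases "{A \<in> P. t \<in> B A} = {}") (auto simp: \<phi>_def pick_def)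
  have det: "determined_by_prefix Q \<phi>"
  proof -
    have "determined_by_prefix Q (\<lambda>t. t \<in> B A)" if "A \<in> P" for A
      using that P(1) by (intro determined_by_prefix_mono[OF B(1)[OF that]])
        (auto simp: Q_def intro!: member_le_sum)
    hence "determined_by_prefix Q (\<lambda>t. {A \<in> P. t \<in> B A})"
      unfolding determined_by_prefix_def by blast
    thus ?thesis unfolding \<phi>_def by (rule determined_by_prefix_comp)
  qed
  have bad: "{t \<in> space \<nu>. t \<notin> \<phi> t} = space \<nu> - (\<Union>A\<in>P. A \<inter> {t \<in> space \<nu>. t \<in> {t. \<phi> t = A}})"
    using \<phi>P by auto
  have sets: "{t \<in> space \<nu>. t \<notin> \<phi> t} \<in> sets \<nu>"
    unfolding bad
  proof (intro sets.Diff sets.top sets.finite_UN P(1) sets.Int)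
    fix A assume "A \<in> P"
    thus "A \<in> sets \<nu>" using P(2) by blast
    show "{t \<in> space \<nu>. t \<in> {t. \<phi> t = A}} \<in> sets \<nu>"
      by (rule determined_by_prefix_sets[of Q]) (use determined_by_prefix_comp[OF det, of "\<lambda>X. X = A"] in simp)
  qed
  have sE: "E A \<in> sets \<nu>" if "A \<in> P" for A
    unfolding E_def using sets_mismatch[OF _ B(1)[OF that]] that P(2) by blast
  have "{t \<in> space \<nu>. t \<notin> \<phi> t} \<subseteq> (\<Union>A\<in>P. E A)"
  proof
    fix t assume t: "t \<in> {t \<in> space \<nu>. t \<notin> \<phi> t}"
    show "t \<in> (\<Union>A\<in>P. E A)"
    proof (rule ccontr)
      assume not: "t \<notin> (\<Union>A\<in>P. E A)"
      obtain A where A: "A \<in> P" "t \<in> A" using t partition_onD1[OF P(3)] by blast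
      hence "A \<in> {A \<in> P. t \<in> B A}" using not t by (auto simp: E_def)
      hence "\<phi> t \<in> {A \<in> P. t \<in> B A}" unfolding \<phi>_def by (intro pick) blast
      hence "t \<in> \<phi> t" using not t by (auto simp: E_def)
      thus False using t by blast
    qed
  qed
  hence "prob {t \<in> space \<nu>. t \<notin> \<phi> t} \<le> prob (\<Union>A\<in>P. E A)"
    using sE P(1) by (intro finite_measure_mono) auto
  also have "\<dots> \<le> (\<Sum>A\<in>P. prob (E A))"
    using sE P(1) by (intro finite_measure_subadditive_finite) auto
  also have "\<dots> < (\<Sum>A\<in>P. d)"
    using P(1) \<open>P \<noteq> {}\<close> B(2) by (intro sum_strict_mono) (auto simp: E_def)
  also have "\<dots> = e" using card by (simp add: d_def)
  finally show ?thesis using that[OF det \<phi>P sets] by blast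
qed

end

section \<open>Entropy and frequency of a word\<close>

definition block :: "nat \<Rightarrow> (nat \<Rightarrow> nat) \<Rightarrow> nat \<Rightarrow> nat \<Rightarrow> nat" where
  "block l t b = (\<lambda>j\<in>{1..l}. t (b * l + j))"

text \<open>
  The digit sequence obtained by concatenating the words \<open>u 0\<close>, \<open>u 1\<close>, \<dots>; the positions in the words
  and in the result start with \<open>1\<close>.
\<close>

definition unblock :: "nat \<Rightarrow> (nat \<Rightarrow> nat \<Rightarrow> nat) \<Rightarrow> nat \<Rightarrow> nat" where
  "unblock l u j = u ((j - 1) div l) ((j - 1) mod l + 1)"

lemma unblock_restrict_block:
  assumes l: "1 \<le> l" and j: "1 \<le> j" "j \<le> B * l"
  shows "unblock l (restrict (block l t) {..<B}) j = t j"
proof -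
  have "(j - 1) div l < B"
    using l j by (intro div_less_iff_less_mult[THEN iffD2]) auto
  moreover have "(j - 1) mod l < l" using l by (intro mod_less_divisor) auto
  moreover have "(j - 1) div l * l + ((j - 1) mod l + 1) = j"
    using j div_mult_mod_eq[of "j - 1" l] by linarith
  ultimately show ?thesis by (simp add: unblock_def block_def)
qed

lemma block_in_words:
  assumes "t \<in> shift_space m"
  shows "block l t b \<in> {1..l} \<rightarrow>\<^sub>E {..<m}"
proof -
  have "t (b * l + j) < m" if "j \<in> {1..l}" for j
    using PiE_mem[OF assms[unfolded shift_space_def], of "b * l + j"] that by auto
  thus ?thesis unfolding block_def by (intro restrict_PiE_iff[THEN iffD2]) auto
qed

lemma block_eq_pattern_iff:
  assumes "t \<in> shift_space m"
  shows "block l t b = restrict \<epsilon> {1..l} \<longleftrightarrow> (shift ^^ (b * l)) t \<in> cylinder m l \<epsilon>"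
proof -
  have "block l t b = restrict \<epsilon> {1..l} \<longleftrightarrow> (\<forall>j\<in>{1..l}. t (b * l + j) = \<epsilon> j)"
    unfolding block_def by (auto simp: fun_eq_iff)
  also have "\<dots> \<longleftrightarrow> (\<forall>j\<in>{1..l}. (shift ^^ (b * l)) t j = \<epsilon> j)"
    by (intro ball_cong) (auto simp: funpow_shift_apply)
  finally show ?thesis
    using assms by (auto simp: cylinder_def funpow_shift_in_shift_space)
qed

text \<open>
  The law \<open>g\<close> of the random itinerary is a sum over all sequences of \<open>B\<close> words. It is bounded from below at the
  itinerary of \<open>t\<close> by the single summand in which the words are those of \<open>t\<close> itself. The logarithm
  of that summand is a sum of functions of iterates of \<open>t\<close>, whose integral follows from invariance: a
  word contributes \<open>s \<nu>(C) - ln Z\<close>, an entry of the itinerary contributes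
  \<open>ln (1 - \<eta>)\<close>, or \<open>ln (\<eta> / card P)\<close> if \<open>\<phi>\<close> selects the wrong atom.
\<close>

lemma itinerary_entropy_tilted_bound:
  fixes s \<eta> :: real
  assumes \<nu>: "\<nu> \<in> invariant_measures m" and m: "2 \<le> m" and l: "1 \<le> l"
    and \<epsilon>: "\<And>j. j \<in> {1..l} \<Longrightarrow> \<epsilon> j < m"
    and P: "finite P" "P \<subseteq> sets \<nu>" "partition_on (space \<nu>) P"
    and \<phi>: "determined_by_prefix q \<phi>" "\<And>t. \<phi> t \<in> P" "{t \<in> space \<nu>. t \<notin> \<phi> t} \<in> sets \<nu>"
    and \<eta>: "0 < \<eta>" "\<eta> < 1" and B: "n + q \<le> B * l"
  defines "Z \<equiv> real m ^ l - 1 + exp s" and "\<beta> \<equiv> measure \<nu> {t \<in> space \<nu>. t \<notin> \<phi> t}"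
  shows "itinerary_entropy \<nu> shift P n
    \<le> real B * (ln Z - s * measure \<nu> (cylinder m l \<epsilon>))
      + real n * (- ln (1 - \<eta>) + \<beta> * ln (real (card P) / \<eta>))"
proof -
  interpret measure_preserving_partition \<nu> shift P
    using measure_preserving_shift[OF \<nu>] P
    by (simp add: measure_preserving_partition_def measure_preserving_partition_axioms_def)
  note space = space_invariant[OF \<nu>]
  define W where "W = {1..l} \<rightarrow>\<^sub>E {..<m}"
  define e where "e = restrict \<epsilon> {1..l}"
  define r where "r w = exp (if w = e then s else 0) / Z" for w
  define K where "K x y = (if x = y then 1 - \<eta> else \<eta> / real (card P))" for x y :: "(nat \<Rightarrow> nat) set"
  define bad where "bad = {t \<in> space \<nu>. t \<notin> \<phi> t}"
  define C where "C = cylinder m l \<epsilon>"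
  \<comment> \<open>\<open>f\<close> and \<open>\<kappa>\<close> are the logarithms of the weight of a word and of an entry of the kernel.\<close>
  define f where "f t = s * indicator C t - ln Z" for t
  define \<kappa> where "\<kappa> t = ln (1 - \<eta>) + (ln (\<eta> / real (card P)) - ln (1 - \<eta>)) * indicator bad t" for t
  define F where "F t = (\<Sum>b<B. f ((shift ^^ (b * l)) t)) + (\<Sum>i<n. \<kappa> ((shift ^^ i) t))" for t
  define U where "U = {..<B} \<rightarrow>\<^sub>E W"
  define g where "g x = (\<Sum>u\<in>U. (\<Prod>b<B. r (u b)) * (\<Prod>i<n. K (x i) (\<phi> ((shift ^^ i) (unblock l u)))))" for x
  have fW: "finite W" unfolding W_def by (intro finite_PiE) auto
  have fU: "finite U" unfolding U_def by (intro finite_PiE fW) auto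
  have eW: "e \<in> W" unfolding e_def W_def using \<epsilon> by (intro restrict_PiE_iff[THEN iffD2]) auto
  have "1 \<le> real m ^ l" using m by (intro one_le_power) auto
  hence Z: "0 < Z" unfolding Z_def using exp_gt_zero[of s] by linarith
  have cP: "0 < real (card P)" using P(1) \<phi>(2) by (auto simp: card_gt_0_iff)
  have rpos: "0 < r w" for w unfolding r_def using Z by simp
  have Kpos: "0 < K x y" for x y unfolding K_def using \<eta> cP by simp
  have sets_C: "C \<in> sets \<nu>" unfolding C_def by (rule openin_sets[OF \<nu> openin_cylinder])
  have sets_bad: "bad \<in> sets \<nu>" unfolding bad_def by (rule \<phi>(3))
  have int_ind: "integrable \<nu> (\<lambda>t. c * indicat_real A t)" if "A \<in> sets \<nu>" for c A
    by (intro integrable_mult_right integrable_real_indicator that) (simp add: less_top[symmetric])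
  have expectation_ind: "(\<integral>t. c * indicat_real A t \<partial>\<nu>) = c * prob A" if "A \<in> sets \<nu>" for c A
    using that by (simp add: sets.Int_space_eq2)
  have int_f: "integrable \<nu> f" unfolding f_def
    by (intro Bochner_Integration.integrable_diff int_ind integrable_const sets_C)
  have int_\<kappa>: "integrable \<nu> \<kappa>" unfolding \<kappa>_def
    by (intro Bochner_Integration.integrable_add int_ind integrable_const sets_bad)
  have int: "integrable \<nu> (\<lambda>t. f ((shift ^^ i) t))" "integrable \<nu> (\<lambda>t. \<kappa> ((shift ^^ i) t))" for i
    using integrable_iterate int_f int_\<kappa> by blast+
  have "itinerary_entropy \<nu> shift P n \<le> - (\<integral>t. F t \<partial>\<nu>)"
  proof (rule itinerary_entropy_le[where g = g])
    show "0 \<le> g x" for x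
      unfolding g_def by (intro sum_nonneg mult_nonneg_nonneg prod_nonneg ballI less_imp_le rpos Kpos)
    show "integrable \<nu> F"
      unfolding F_def by (intro Bochner_Integration.integrable_add Bochner_Integration.integrable_sum int)
    have sumr: "(\<Sum>u\<in>U. \<Prod>b<B. r (u b)) = 1"
    proof -
      have "(\<Sum>u\<in>U. \<Prod>b<B. r (u b)) = (\<Prod>b<B. \<Sum>w\<in>W. r w)"
        unfolding U_def by (rule prod_sum_PiE[symmetric]) (auto intro: fW)
      also have "(\<Sum>w\<in>W. r w) = 1"
        unfolding r_def by (rule sum_tilted_weight[OF fW eW Z]) (simp add: Z_def W_def card_PiE)
      finally show ?thesis by simp
    qed
    have sumK: "(\<Sum>x\<in>{..<n} \<rightarrow>\<^sub>E P. \<Prod>i<n. K (x i) (y i)) \<le> 1" if "\<And>i. y i \<in> P" for y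
    proof -
      have "(\<Sum>x\<in>{..<n} \<rightarrow>\<^sub>E P. \<Prod>i<n. K (x i) (y i)) = (\<Prod>i<n. \<Sum>a\<in>P. K a (y i))"
        by (rule prod_sum_PiE[symmetric]) (auto intro: P(1))
      also have "\<dots> \<le> 1"
      proof (intro prod_le_1 conjI)
        fix i
        show "0 \<le> (\<Sum>a\<in>P. K a (y i))" by (intro sum_nonneg less_imp_le Kpos)
        show "(\<Sum>a\<in>P. K a (y i)) \<le> 1"
          unfolding K_def by (rule sum_near_diagonal_kernel_le[OF P(1) that \<eta>(1)])
      qed
      finally show ?thesis .
    qed
    have "(\<Sum>x\<in>{..<n} \<rightarrow>\<^sub>E P. g x)
        = (\<Sum>u\<in>U. (\<Prod>b<B. r (u b)) * (\<Sum>x\<in>{..<n} \<rightarrow>\<^sub>E P. \<Prod>i<n. K (x i) (\<phi> ((shift ^^ i) (unblock l u)))))"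
      unfolding g_def by (subst sum.swap) (simp only: sum_distrib_left)
    also have "\<dots> \<le> (\<Sum>u\<in>U. (\<Prod>b<B. r (u b)) * 1)"
      by (intro sum_mono mult_left_mono sumK \<phi>(2) prod_nonneg less_imp_le rpos)
    finally show "(\<Sum>x\<in>{..<n} \<rightarrow>\<^sub>E P. g x) \<le> 1" using sumr by simp
  next
    fix x t assume x: "x \<in> {..<n} \<rightarrow>\<^sub>E P" and t: "t \<in> cell n x"
    have tS: "t \<in> shift_space m" using t by (simp add: itinerary_cell_def space)
    define u where "u = restrict (block l t) {..<B}"
    have uU: "u \<in> U"
      unfolding u_def U_def W_def using block_in_words[OF tS] by (intro restrict_PiE_iff[THEN iffD2]) auto
    have r: "r (u b) = exp (f ((shift ^^ (b * l)) t))" if "b < B" for b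
    proof -
      have "u b = e \<longleftrightarrow> (shift ^^ (b * l)) t \<in> C"
        using that block_eq_pattern_iff[OF tS] by (simp add: u_def e_def C_def)
      thus ?thesis using Z by (simp add: r_def f_def exp_diff)
    qed
    have K: "K (x i) (\<phi> ((shift ^^ i) (unblock l u))) = exp (\<kappa> ((shift ^^ i) t))" if i: "i < n" for i
    proof -
      have "\<phi> ((shift ^^ i) (unblock l u)) = \<phi> ((shift ^^ i) t)"
      proof (rule determined_by_prefixD[OF \<phi>(1)])
        fix j assume j: "1 \<le> j" "j \<le> q"
        have "i + j \<le> B * l" using i j B by linarith
        thus "(shift ^^ i) (unblock l u) j = (shift ^^ i) t j"
          using j l by (simp add: funpow_shift_apply u_def unblock_restrict_block)
      qed
      moreover have "x i = \<phi> ((shift ^^ i) t) \<longleftrightarrow> (shift ^^ i) t \<notin> bad"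
      proof -
        have ts: "(shift ^^ i) t \<in> space \<nu>"
          using tS by (simp add: space funpow_shift_in_shift_space)
        have "x i \<in> P" "(shift ^^ i) t \<in> x i"
          using x t i by (auto simp: itinerary_cell_def)
        thus ?thesis using ex1_atom[OF ts] \<phi>(2)[of "(shift ^^ i) t"] ts by (auto simp: bad_def)
      qed
      ultimately show ?thesis using \<eta> cP by (simp add: K_def \<kappa>_def)
    qed
    \<comment> \<open>\<open>F t\<close> is the logarithm of the summand of \<open>g x\<close> belonging to the words of \<open>t\<close>.\<close>
    have "exp (F t) = (\<Prod>b<B. r (u b)) * (\<Prod>i<n. K (x i) (\<phi> ((shift ^^ i) (unblock l u))))"
      by (simp add: F_def exp_add exp_sum r K)
    also have "\<dots> \<le> g x"
      unfolding g_def by (rule member_le_sum[OF uU _ fU])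
        (intro mult_nonneg_nonneg prod_nonneg ballI less_imp_le rpos Kpos)
    finally have "exp (F t) \<le> g x" .
    moreover from this have "0 < g x" by (rule less_le_trans[OF exp_gt_zero])
    ultimately show "0 < g x \<and> F t \<le> ln (g x)" by (simp add: ln_ge_iff)
  qed
  also have "(\<integral>t. F t \<partial>\<nu>) = (\<Sum>b<B. \<integral>t. f t \<partial>\<nu>) + (\<Sum>i<n. \<integral>t. \<kappa> t \<partial>\<nu>)"
  proof -
    have "(\<integral>t. F t \<partial>\<nu>) = (\<integral>t. (\<Sum>b<B. f ((shift ^^ (b * l)) t)) \<partial>\<nu>) + (\<integral>t. (\<Sum>i<n. \<kappa> ((shift ^^ i) t)) \<partial>\<nu>)"
      unfolding F_def by (intro Bochner_Integration.integral_add Bochner_Integration.integrable_sum int)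
    thus ?thesis
      using int_f int_\<kappa> by (simp add: Bochner_Integration.integral_sum int integral_iterate)
  qed
  also have "(\<integral>t. f t \<partial>\<nu>) = s * prob C - ln Z"
    unfolding f_def Bochner_Integration.integral_diff[OF int_ind[OF sets_C] integrable_const]
      expectation_ind[OF sets_C] by (simp add: prob_space)
  also have "(\<integral>t. \<kappa> t \<partial>\<nu>) = ln (1 - \<eta>) + (ln (\<eta> / real (card P)) - ln (1 - \<eta>)) * \<beta>"
    unfolding \<kappa>_def Bochner_Integration.integral_add[OF integrable_const int_ind[OF sets_bad]]
      expectation_ind[OF sets_bad] by (simp add: prob_space \<beta>_def bad_def)
  also have "- ((\<Sum>b<B. s * prob C - ln Z) + (\<Sum>i<n. ln (1 - \<eta>) + (ln (\<eta> / real (card P)) - ln (1 - \<eta>)) * \<beta>))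
    = real B * (ln Z - s * prob C) + real n * (- ln (1 - \<eta>) + \<beta> * (ln (real (card P) / \<eta>) + ln (1 - \<eta>)))"
    using \<eta> cP by (simp add: ln_div algebra_simps)
  also have "\<dots> \<le> real B * (ln Z - s * prob C) + real n * (- ln (1 - \<eta>) + \<beta> * ln (real (card P) / \<eta>))"
    using \<eta> by (intro add_left_mono mult_left_mono) (auto simp: \<beta>_def)
  finally show ?thesis by (simp add: C_def)
qed

text \<open>
  About \<open>n / l\<close> words are needed for an itinerary of length \<open>n\<close>. The error terms vanish when \<open>\<eta>\<close> is
  chosen small and then the measure \<open>\<beta>\<close> of the exceptional set is chosen small depending on \<open>\<eta>\<close>.
\<close>

lemma ks_entropy_tilted_bound:
  fixes s :: real
  assumes \<nu>: "\<nu> \<in> invariant_measures m" and m: "2 \<le> m" and l: "1 \<le> l"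
    and \<epsilon>: "\<And>j. j \<in> {1..l} \<Longrightarrow> \<epsilon> j < m"
  shows "ks_entropy \<nu> shift
    \<le> ereal ((ln (real m ^ l - 1 + exp s) - s * measure \<nu> (cylinder m l \<epsilon>)) / real l)"
  unfolding ks_entropy_def
proof (intro SUP_least, clarify)
  fix P assume P: "finite P" "P \<subseteq> sets \<nu>" "partition_on (space \<nu>) P"
  define a where "a = ln (real m ^ l - 1 + exp s) - s * measure \<nu> (cylinder m l \<epsilon>)"
  interpret measure_preserving_partition \<nu> shift P
    using measure_preserving_shift[OF \<nu>] P
    by (simp add: measure_preserving_partition_def measure_preserving_partition_axioms_def)
  have "P \<noteq> {}" using P(3) not_empty by (auto simp: partition_on_def)
  hence cP: "1 \<le> real (card P)" using P(1) by (simp add: Suc_le_eq card_gt_0_iff)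
  have "entropy_wrt_partition \<nu> shift P \<le> a / real l"
  proof (rule field_le_epsilon)
    fix d :: real assume d: "0 < d"
    define \<eta> where "\<eta> = min (1 / 2) (d / 4)"
    have \<eta>: "0 < \<eta>" "\<eta> \<le> 1 / 2" "\<eta> \<le> d / 4" using d by (auto simp: \<eta>_def)
    have "- \<eta> - 2 * \<eta>\<^sup>2 \<le> ln (1 - \<eta>)"
      using \<eta> by (intro ln_one_minus_pos_lower_bound) auto
    moreover have "\<eta>\<^sup>2 \<le> \<eta> * (1 / 2)"
      using \<eta> unfolding power2_eq_square by (intro mult_left_mono) auto
    ultimately have small: "- ln (1 - \<eta>) \<le> d / 2" using \<eta> by linarith
    define L where "L = ln (real (card P) / \<eta>)"
    have "0 < L" unfolding L_def using cP \<eta> by (intro ln_gt_zero) (auto simp: field_simps)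
    define b where "b = d / (2 * L)"
    have "0 < b" using d \<open>0 < L\<close> by (simp add: b_def)
    then obtain q \<phi> where \<phi>: "determined_by_prefix q \<phi>" "\<And>t. \<phi> t \<in> P"
      "{t \<in> space \<nu>. t \<notin> \<phi> t} \<in> sets \<nu>" "prob {t \<in> space \<nu>. t \<notin> \<phi> t} < b"
      using ex_prefix_partition_approximation[OF \<nu> P] by blast
    define \<beta> where "\<beta> = prob {t \<in> space \<nu>. t \<notin> \<phi> t}"
    have "\<beta> * L \<le> b * L" using \<phi>(4) \<open>0 < L\<close> by (intro mult_right_mono) (auto simp: \<beta>_def)
    hence \<beta>: "\<beta> * L \<le> d / 2" using \<open>0 < L\<close> by (simp add: b_def)
    have bound: "itinerary_entropy \<nu> shift P n / real n
        \<le> real ((n + q) div l + 1) / real n * a + d" if n: "1 \<le> n" for n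
    proof -
      have "n + q < ((n + q) div l + 1) * l"
        using l dividend_less_div_times[of l "n + q"] by simp
      hence "itinerary_entropy \<nu> shift P n \<le> real ((n + q) div l + 1) * a
          + real n * (- ln (1 - \<eta>) + \<beta> * L)"
        unfolding a_def \<beta>_def L_def
        using \<eta> by (intro itinerary_entropy_tilted_bound[OF \<nu> m l \<epsilon> P \<phi>(1-3)]) auto
      also have "\<dots> \<le> real ((n + q) div l + 1) * a + real n * d"
        using small \<beta> by (intro add_left_mono mult_left_mono) auto
      finally have "itinerary_entropy \<nu> shift P n \<le> real ((n + q) div l + 1) * a + real n * d" .
      hence "itinerary_entropy \<nu> shift P n / real n \<le> (real ((n + q) div l + 1) * a + real n * d) / real n"
        by (rule divide_right_mono) simp
      also have "\<dots> = real ((n + q) div l + 1) / real n * a + d"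
        using n by (simp only: add_divide_distrib) simp
      finally show ?thesis .
    qed
    have "(\<lambda>n. real ((n + q) div l + 1) / real n * a + d) \<longlonglongrightarrow> 1 / real l * a + d"
      by (intro tendsto_intros LIMSEQ_div_over l)
    from LIMSEQ_le[OF entropy_wrt_partition_LIMSEQ this] bound
    have "entropy_wrt_partition \<nu> shift P \<le> 1 / real l * a + d" by blast
    thus "entropy_wrt_partition \<nu> shift P \<le> a / real l + d" by simp
  qed
  thus "ereal (entropy_wrt_partition \<nu> shift P)
    \<le> ereal ((ln (real m ^ l - 1 + exp s) - s * measure \<nu> (cylinder m l \<epsilon>)) / real l)"
    by (simp add: a_def)
qed

lemma ks_entropy_nonneg:
  assumes \<nu>: "\<nu> \<in> invariant_measures m"
  shows "0 \<le> ks_entropy \<nu> shift"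
proof -
  interpret measure_preserving \<nu> shift by (rule measure_preserving_shift[OF \<nu>])
  have part: "partition_on (space \<nu>) {space \<nu>}"
    using not_empty by (intro partition_onI) auto
  interpret measure_preserving_partition \<nu> shift "{space \<nu>}"
    by unfold_locales (use part in auto)
  have "ereal (entropy_wrt_partition \<nu> shift {space \<nu>}) \<le> ks_entropy \<nu> shift"
    unfolding ks_entropy_def by (rule SUP_upper) (use part in auto)
  thus ?thesis using entropy_wrt_partition_nonneg by (metis ereal_less_eq(5) order_trans)
qed

text \<open>
  Choosing the tilt by \<open>ex_tilt\<close> quantifies that only measures with uniformly distributed words have
  entropy close to \<open>log m\<close>.
\<close>

lemma entropy_gap:
  assumes \<nu>: "\<nu> \<in> invariant_measures m" and m: "2 \<le> m" and l: "1 \<le> l"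
    and \<epsilon>: "\<And>j. j \<in> {1..l} \<Longrightarrow> \<epsilon> j < m" and \<delta>: "0 < \<delta>" "\<delta> \<le> 1"
    and dev: "\<delta> \<le> \<bar>measure \<nu> (cylinder m l \<epsilon>) - 1 / real m ^ l\<bar>"
  shows "ks_entropy \<nu> shift \<le> ereal (ln (real m) - \<delta>\<^sup>2 / (2 * real l))"
proof -
  have "(2::real) \<le> real m ^ l"
  proof -
    have "(2::real) ^ 1 \<le> 2 ^ l" using l by (intro power_increasing) auto
    also have "\<dots> \<le> real m ^ l" using m by (intro power_mono) auto
    finally show ?thesis by simp
  qed
  then obtain s where s: "ln (real m ^ l - 1 + exp s) - s * measure \<nu> (cylinder m l \<epsilon>)
      \<le> ln (real m ^ l) - \<delta>\<^sup>2 / 2"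
    using ex_tilt[OF _ \<delta> dev] by blast
  note ks_entropy_tilted_bound[OF \<nu> m l \<epsilon>, where s = s]
  also have "(ln (real m ^ l - 1 + exp s) - s * measure \<nu> (cylinder m l \<epsilon>)) / real l
      \<le> (ln (real m ^ l) - \<delta>\<^sup>2 / 2) / real l"
    using s by (rule divide_right_mono) simp
  also have "\<dots> = ln (real m) - \<delta>\<^sup>2 / (2 * real l)"
    using l m by (simp add: ln_realpow diff_divide_distrib)
  finally show ?thesis by simp
qed

section \<open>The rate function of a cylinder indicator\<close>

text \<open>
  The condition \<open>i < 1\<close> embeds the real-valued indicator into \<open>Euclidean_space 1\<close>.
\<close>

definition cylinder_observable :: "nat \<Rightarrow> nat \<Rightarrow> (nat \<Rightarrow> nat) \<Rightarrow> (nat \<Rightarrow> nat) \<Rightarrow> nat \<Rightarrow> real" where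
  "cylinder_observable m l \<epsilon> = (\<lambda>t i. if i < 1 then indicator (cylinder m l \<epsilon>) t else 0)"

lemma continuous_cylinder_observable:
  "continuous_map (shift_top m) (Euclidean_space 1) (cylinder_observable m l \<epsilon>)"
  unfolding cylinder_observable_def continuous_map_componentwise_Euclidean_space
  by (intro allI impI continuous_map_indicator_clopen openin_cylinder closedin_cylinder)

lemma mean_cylinder_observable:
  assumes "\<nu> \<in> invariant_measures m"
  shows "mean \<nu> (cylinder_observable m l \<epsilon>) 0 = measure \<nu> (cylinder m l \<epsilon>)"
  using openin_sets[OF assms openin_cylinder]
  by (simp add: mean_def cylinder_observable_def sets.Int_space_eq2)

lemma rate_le_ln:
  assumes "x \<in> rate_domain m \<Phi>"
  shows "rate m \<Phi> x \<le> ereal (ln (real m))"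
proof -
  obtain \<nu> where \<nu>: "\<nu> \<in> invariant_measures m" "mean \<nu> \<Phi> = x"
    using assms by (auto simp: rate_domain_def)
  have "rate m \<Phi> x \<le> ereal (ln (real m)) - ks_entropy \<nu> shift"
    using assms \<nu> by (auto simp: rate_def intro: INF_lower)
  also have "\<dots> \<le> ereal (ln (real m)) - 0"
    by (intro ereal_minus_mono ks_entropy_nonneg[OF \<nu>(1)]) simp
  finally show ?thesis by simp
qed

lemma rate_cylinder_observable_ge:
  assumes m: "2 \<le> m" and l: "1 \<le> l" and \<epsilon>: "\<And>j. j \<in> {1..l} \<Longrightarrow> \<epsilon> j < m"
    and \<delta>: "0 < \<delta>" "\<delta> \<le> 1" and x: "\<delta> \<le> \<bar>x 0 - 1 / real m ^ l\<bar>"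
  shows "ereal (\<delta>\<^sup>2 / (2 * real l)) \<le> rate m (cylinder_observable m l \<epsilon>) x"
proof (cases "x \<in> rate_domain m (cylinder_observable m l \<epsilon>)")
  case True
  have "ereal (\<delta>\<^sup>2 / (2 * real l)) \<le> ereal (ln (real m)) - ks_entropy \<nu> shift"
    if \<nu>: "\<nu> \<in> invariant_measures m" and mean: "mean \<nu> (cylinder_observable m l \<epsilon>) = x" for \<nu>
  proof -
    have "\<delta> \<le> \<bar>measure \<nu> (cylinder m l \<epsilon>) - 1 / real m ^ l\<bar>"
      using x mean_cylinder_observable[OF \<nu>, of l \<epsilon>] mean by simp
    from entropy_gap[OF \<nu> m l \<epsilon> \<delta> this]
    have "ereal (ln (real m)) - ereal (ln (real m) - \<delta>\<^sup>2 / (2 * real l)) \<le> ereal (ln (real m)) - ks_entropy \<nu> shift"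
      by (intro ereal_minus_mono) auto
    thus ?thesis by simp
  qed
  thus ?thesis using True by (auto simp: rate_def intro!: INF_greatest)
qed (simp add: rate_def)

section \<open>Large deviations of empirical word frequencies\<close>

text \<open>
  Only the upper bound of the principle matters: it gives an exponential decay of the masses of \<open>S\<close>.
\<close>

lemma LDP_imp_eventually_small:
  assumes LDP: "satisfies_LDP X \<mu> I" and S: "closedin X S"
    and I: "\<And>x. x \<in> S \<Longrightarrow> ereal \<eta> \<le> I x" and \<eta>: "0 < \<eta>"
    and \<mu>: "\<And>n. 0 \<le> \<mu> n S" and e: "0 < e"
  shows "\<forall>\<^sub>F n in sequentially. \<mu> n S < e"
proof -
  have "limsup (\<lambda>n. ereal (1 / real n) * elog (\<mu> n S)) \<le> - (INF x\<in>X closure_of S. I x)"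
    using LDP closedin_imp_borel[OF S] unfolding satisfies_LDP_def by blast
  also have "X closure_of S = S" using S by (simp add: closure_of_closedin)
  also have "- (INF x\<in>S. I x) \<le> - ereal \<eta>"
    using I by (subst ereal_minus_le_minus) (auto intro: INF_greatest)
  also have "\<dots> < ereal (- \<eta> / 2)" using \<eta> by simp
  finally have "\<forall>\<^sub>F n in sequentially. ereal (1 / real n) * elog (\<mu> n S) < ereal (- \<eta> / 2)"
    by (rule Limsup_lessD)
  moreover have "\<forall>\<^sub>F n in sequentially. - 2 * ln e / \<eta> < real n"
    using filterlim_real_sequentially unfolding filterlim_at_top_dense by blast
  ultimately show ?thesis
    using eventually_ge_at_top[of 1]
  proof eventually_elim
    case (elim n)
    show "\<mu> n S < e"
    proof (cases "\<mu> n S = 0")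
      case False
      hence pos: "0 < \<mu> n S" using \<mu>[of n] by simp
      have "1 / real n * ln (\<mu> n S) < - \<eta> / 2"
        using elim(1) False by (simp add: elog_def)
      hence "ln (\<mu> n S) < - \<eta> / 2 * real n" using elim(3) by (simp add: field_simps)
      also have "\<dots> < ln e" using elim(2) \<eta> by (simp add: field_simps)
      finally show ?thesis using pos e by simp
    qed (use e in simp)
  qed
qed

lemma card_occurrences_eq_sum:
  assumes "D \<in> shift_space m"
  shows "real (card {i\<in>{1..K}. \<forall>j\<in>{1..l}. D (i + j - 1) = \<epsilon> j})
    = (\<Sum>i<K. indicator (cylinder m l \<epsilon>) ((shift ^^ i) D))"
proof -
  have iff: "(\<forall>j\<in>{1..l}. D (i + 1 + j - 1) = \<epsilon> j) \<longleftrightarrow> (shift ^^ i) D \<in> cylinder m l \<epsilon>" for i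
    using assms by (auto simp: cylinder_def funpow_shift_in_shift_space funpow_shift_apply)
  have "{i\<in>{1..K}. \<forall>j\<in>{1..l}. D (i + j - 1) = \<epsilon> j} = Suc ` {i\<in>{..<K}. (shift ^^ i) D \<in> cylinder m l \<epsilon>}"
  proof (rule set_eqI iffI)+
    fix i assume i: "i \<in> {i\<in>{1..K}. \<forall>j\<in>{1..l}. D (i + j - 1) = \<epsilon> j}"
    then obtain i' where "i = Suc i'" by (cases i) auto
    thus "i \<in> Suc ` {i\<in>{..<K}. (shift ^^ i) D \<in> cylinder m l \<epsilon>}"
      using i iff[of i'] by auto
  next
    fix i assume "i \<in> Suc ` {i\<in>{..<K}. (shift ^^ i) D \<in> cylinder m l \<epsilon>}"
    then obtain i' where "i = Suc i'" "i' < K" "(shift ^^ i') D \<in> cylinder m l \<epsilon>" by blast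
    thus "i \<in> {i\<in>{1..K}. \<forall>j\<in>{1..l}. D (i + j - 1) = \<epsilon> j}"
      using iff[of i'] by auto
  qed
  hence "card {i\<in>{1..K}. \<forall>j\<in>{1..l}. D (i + j - 1) = \<epsilon> j} = card {i\<in>{..<K}. (shift ^^ i) D \<in> cylinder m l \<epsilon>}"
    by (simp only: card_image[OF inj_on_subset[OF inj_Suc subset_UNIV]])
  also have "real \<dots> = (\<Sum>i<K. indicator (cylinder m l \<epsilon>) ((shift ^^ i) D))"
    by (simp add: indicator_def sum.If_cases Int_def)
  finally show ?thesis .
qed

definition deviation_set :: "real \<Rightarrow> real \<Rightarrow> (nat \<Rightarrow> real) set" where
  "deviation_set p \<delta> = {x \<in> topspace (Euclidean_space 1). \<delta> \<le> \<bar>x 0 - p\<bar>}"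

lemma closedin_deviation_set: "closedin (Euclidean_space 1) (deviation_set p \<delta>)"
proof -
  have "continuous_map (Euclidean_space 1) euclideanreal (\<lambda>x. x 0)"
    unfolding Euclidean_space_def
    by (intro continuous_map_from_subtopology continuous_map_product_projection) auto
  moreover have "closedin euclideanreal {y. \<delta> \<le> \<bar>y - p\<bar>}"
    by (simp add: closed_Collect_le continuous_intros)
  ultimately have "closedin (Euclidean_space 1) {x \<in> topspace (Euclidean_space 1). x 0 \<in> {y. \<delta> \<le> \<bar>y - p\<bar>}}"
    by (rule closedin_continuous_map_preimage)
  thus ?thesis by (simp add: deviation_set_def)
qed

lemma empirical_distribution_deviation_set:
  "empirical_distribution (cylinder_observable m l \<epsilon>) D n N (deviation_set p \<delta>)
    = (\<Sum>j<N. of_bool (\<delta> \<le> \<bar>(\<Sum>i<n. indicator (cylinder m l \<epsilon>) ((shift ^^ (j * n + i)) D)) / real n - p\<bar>)) / real N"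
proof -
  have "indicator (deviation_set p \<delta>) (birkhoff_average (cylinder_observable m l \<epsilon>) n ((shift ^^ (j * n)) D))
    = (of_bool (\<delta> \<le> \<bar>(\<Sum>i<n. indicator (cylinder m l \<epsilon>) ((shift ^^ (j * n + i)) D)) / real n - p\<bar>) :: real)" for j
  proof -
    have "(shift ^^ i) ((shift ^^ (j * n)) D) = (shift ^^ (j * n + i)) D" for i
      by (subst add.commute) (simp only: funpow_add comp_apply)
    thus ?thesis
      by (simp add: deviation_set_def topspace_Euclidean_space birkhoff_average_def
          cylinder_observable_def indicator_def[of "Collect _"])
  qed
  moreover
  have "(\<Sum>j=1..N. h (j - 1)) = (\<Sum>j<N. h j)" for h :: "nat \<Rightarrow> real"
    by (rule sum.reindex_bij_witness[of _ Suc "\<lambda>j. j - 1"]) auto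
  note this[of "\<lambda>j. indicator (deviation_set p \<delta>)
      (birkhoff_average (cylinder_observable m l \<epsilon>) n ((shift ^^ (j * n)) D))"]
  ultimately show ?thesis
    unfolding empirical_distribution_def by (simp only:)
qed

section \<open>Normality\<close>

theorem theorem4p1:
  fixes m :: nat and D :: "nat \<Rightarrow> nat"
  assumes "m \<ge> 2"
    and "D \<in> shift_space m"
    and "property_P m D"
  shows "\<forall>n\<^sub>0\<ge>1. \<forall>\<epsilon> :: nat \<Rightarrow> nat. (\<forall>j\<in>{1..n\<^sub>0}. \<epsilon> j < m) \<longrightarrow>
    (\<lambda>k. real (card {i\<in>{1..k}. \<forall>j\<in>{1..n\<^sub>0}. D (i + j - 1) = \<epsilon> j}) / real k)
      \<longlonglongrightarrow> 1 / real m ^ n\<^sub>0"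
proof (intro allI impI)
  fix l :: nat and \<epsilon> :: "nat \<Rightarrow> nat"
  assume l: "1 \<le> l" and "\<forall>j\<in>{1..l}. \<epsilon> j < m"
  hence \<epsilon>: "\<And>j. j \<in> {1..l} \<Longrightarrow> \<epsilon> j < m" by blast
  define p where "p = 1 / real m ^ l"
  define a where "a i = indicat_real (cylinder m l \<epsilon>) ((shift ^^ i) D)" for i
  define freq where "freq K = (\<Sum>i<K. a i) / real K" for K
  have "freq \<longlonglongrightarrow> p"
  proof (rule ccontr)
    assume "\<not> freq \<longlonglongrightarrow> p"
    then obtain e where e: "0 < e" and "\<forall>K0. \<exists>K\<ge>K0. \<not> norm (freq K - p) < e"
      unfolding LIMSEQ_iff by blast
    hence bad: "\<exists>K\<ge>K0. e \<le> \<bar>freq K - p\<bar>" for K0 by (auto simp: not_less)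
    define \<delta> where "\<delta> = min 1 (e / 3)"
    have \<delta>: "0 < \<delta>" "\<delta> \<le> 1" "3 * \<delta> \<le> e" using e by (auto simp: \<delta>_def)
    \<comment> \<open>Bad lengths are unbounded, so \<open>K n div n\<close> can be made to grow arbitrarily fast along them. At \<open>n = 0\<close>
this quotient is \<open>0\<close>, which is why the growth is required only for positive \<open>n\<close>.\<close>
    have "\<exists>K. \<forall>n. (e \<le> \<bar>freq (K n) - p\<bar> \<and> (1 \<le> n \<longrightarrow> (m + 1) ^ n \<le> K n div n))
        \<and> K n div n < K (Suc n) div Suc n"
    proof (rule dependent_nat_choice)
      show "\<exists>K. e \<le> \<bar>freq K - p\<bar> \<and> (1 \<le> (0::nat) \<longrightarrow> (m + 1) ^ 0 \<le> K div 0)"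
        using bad[of 0] by auto
      fix K n
      obtain K' where K': "Suc n * max ((m + 1) ^ Suc n) (Suc (K div n)) \<le> K'" "e \<le> \<bar>freq K' - p\<bar>"
        using bad by blast
      have "max ((m + 1) ^ Suc n) (Suc (K div n)) \<le> K' div Suc n"
        using div_le_mono[OF K'(1), of "Suc n"] by (simp only: nonzero_mult_div_cancel_left[OF nat.distinct(2)])
      thus "\<exists>K'. (e \<le> \<bar>freq K' - p\<bar> \<and> (1 \<le> Suc n \<longrightarrow> (m + 1) ^ Suc n \<le> K' div Suc n)) \<and> K div n < K' div Suc n"
        using K'(2) by (intro exI[of _ K']) simp
    qed
    then obtain K where K: "\<And>n. e \<le> \<bar>freq (K n) - p\<bar>"
      "\<And>n. 1 \<le> n \<Longrightarrow> (m + 1) ^ n \<le> K n div n" "\<And>n. K n div n < K (Suc n) div Suc n"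
      by blast
    define k where "k n = K n div n" for n
    define \<Phi> where "\<Phi> = cylinder_observable m l \<epsilon>"
    have mono: "strict_mono k" unfolding k_def by (rule strict_monoI_Suc) (rule K(3))
    have k1: "1 \<le> k n" if "1 \<le> n" for n
      using K(2)[OF that] one_le_power[of "m + 1" n] unfolding k_def by linarith
    have growth: "(SUP x\<in>rate_domain m \<Phi>. rate m \<Phi> x) < liminf (\<lambda>n. ereal (ln (real (k n)) / real n))"
    proof -
      have "(SUP x\<in>rate_domain m \<Phi>. rate m \<Phi> x) \<le> ereal (ln (real m))"
        by (intro SUP_least rate_le_ln)
      also have "\<dots> < ereal (ln (real (m + 1)))" using assms(1) by simp
      also have "\<dots> \<le> liminf (\<lambda>n. ereal (ln (real (k n)) / real n))"
      proof (intro Liminf_bounded eventually_sequentiallyI[of 1])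
        fix n :: nat assume n: "1 \<le> n"
        have "real n * ln (real (m + 1)) = ln (real ((m + 1) ^ n))"
          by (simp add: ln_realpow)
        also have "\<dots> \<le> ln (real (k n))"
        proof (intro ln_mono of_nat_mono)
          show "(m + 1) ^ n \<le> k n" using K(2)[OF n] by (simp add: k_def)
        qed (use k1[OF n] in auto)
        finally show "ereal (ln (real (m + 1))) \<le> ereal (ln (real (k n)) / real n)"
          using n by (simp add: field_simps)
      qed
      finally show ?thesis .
    qed
    have LDP: "satisfies_LDP (Euclidean_space 1) (\<lambda>n. empirical_distribution \<Phi> D n (k n)) (rate m \<Phi>)"
    proof (rule assms(3)[unfolded property_P_def, rule_format])
      show "continuous_map (shift_top m) (Euclidean_space 1) \<Phi>"
        unfolding \<Phi>_def by (rule continuous_cylinder_observable)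
      show "strict_mono_on {1..} k" using mono by (simp add: strict_mono_on_def strict_mono_def)
    qed (use k1 growth in auto)
    have "\<forall>\<^sub>F n in sequentially. empirical_distribution \<Phi> D n (k n) (deviation_set p \<delta>) < \<delta>"
    proof (rule LDP_imp_eventually_small[OF LDP closedin_deviation_set])
      show "ereal (\<delta>\<^sup>2 / (2 * real l)) \<le> rate m \<Phi> x" if "x \<in> deviation_set p \<delta>" for x
        unfolding \<Phi>_def using that
        by (intro rate_cylinder_observable_ge[OF assms(1) l \<epsilon> \<delta>(1,2)]) (auto simp: deviation_set_def p_def)
      show "0 < \<delta>\<^sup>2 / (2 * real l)" using \<delta> l by simp
      show "0 \<le> empirical_distribution \<Phi> D n (k n) (deviation_set p \<delta>)" for n
        unfolding empirical_distribution_def by (intro divide_nonneg_nonneg sum_nonneg) auto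
    qed (rule \<delta>(1))
    moreover have "\<forall>\<^sub>F n in sequentially. 1 / \<delta> < real n"
      using filterlim_real_sequentially unfolding filterlim_at_top_dense by blast
    ultimately have "\<forall>\<^sub>F n in sequentially. False"
      using eventually_ge_at_top[of 1]
    proof eventually_elim
      case (elim n)
      have "\<bar>freq (K n) - p\<bar> \<le> \<delta> + empirical_distribution \<Phi> D n (k n) (deviation_set p \<delta>) + 1 / real (k n)"
        unfolding freq_def \<Phi>_def k_def empirical_distribution_deviation_set
        unfolding a_def
        by (rule frequency_block_estimate)
           (use elim(3) k1[OF elim(3)] \<delta> assms(1) in \<open>auto simp: k_def p_def indicator_def intro!: divide_le_eq_1_pos[THEN iffD2] one_le_power\<close>)
      moreover have "1 / real (k n) \<le> 1 / real n"
        using elim(3) strict_mono_imp_increasing[OF mono, of n] by (intro divide_left_mono) auto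
      moreover have "1 / real n < \<delta>"
        using elim(2,3) \<delta> by (simp add: field_simps)
      ultimately show False using elim(1) K(1)[of n] \<delta>(3) by linarith
    qed
    thus False by simp
  qed
  moreover have "freq = (\<lambda>k. real (card {i\<in>{1..k}. \<forall>j\<in>{1..l}. D (i + j - 1) = \<epsilon> j}) / real k)"
    by (rule ext) (simp only: freq_def a_def card_occurrences_eq_sum[OF assms(2)])
  ultimately show "(\<lambda>k. real (card {i\<in>{1..k}. \<forall>j\<in>{1..l}. D (i + j - 1) = \<epsilon> j}) / real k) \<longlonglongrightarrow> 1 / real m ^ l"
    by (simp only: p_def)
qed

end
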